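(* The zero-temperature topological entropy $H_0$ satisfies $0.3012\le H_0\le 0.3409$.
   Context: $\mathbb{Z}^2$ is the square grid graph, $i\sim j$ iff $\|i-j\|_1=1$. A configuration $\omega\in\{0,1\}^{\mathbb{Z}^2}$ satisfies the recovery rule at site $i$ if ($\omega_i=1$ if and only if $\omega_j=0$ for all four $j\sim i$); otherwise $i$ is a violation. For $\beta>0$ the energy of $\omega$ gets a contribution $-\beta$ from each site where the rule is satisfied and $+\beta$ from each violation. A ground state is a configuration $\eta$ such that no modification of $\eta$ on finitely many sites decreases the total energy, i.e. for every $\omega$ differing from $\eta$ in at most finitely many sites, the sum over all sites of (contribution for $\omega$) $-$ (contribution for $\eta$) is $\ge0$. (The ground states are the configurations satisfying the recovery rule at every site.) For finite $\Lambda$, $\mathcal{G}_\Lambda\subset\{0,1\}^\Lambda$ is the set of restrictions to $\Lambda$ of ground states. With $\mathbb{Z}_{m\times n}=\{-\lfloor m/2\rfloor,\dots,\lfloor m/2\rfloor\}\times\{-\lfloor n/2\rfloor,\dots,\lfloor n/2\rfloor\}$, $$H_0=\lim_{m,n\to\infty}\frac{\log_2|\mathcal{G}_{\mathbb{Z}_{m\times n}}|}{mn}.$$ *)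

theory Defs
  imports "HOL-Analysis.Analysis"
begin

type_synonym site = "int \<times> int"

text \<open>A configuration in \<open>{0,1}^(Z^2)\<close>; \<open>\<omega> i\<close> means \<open>\<omega>_i = 1\<close>.\<close>

type_synonym config = "site \<Rightarrow> bool"

definition adj :: "site \<Rightarrow> site \<Rightarrow> bool" where
  "adj i j \<longleftrightarrow> \<bar>fst i - fst j\<bar> + \<bar>snd i - snd j\<bar> = 1"

definition recovery_rule :: "config \<Rightarrow> site \<Rightarrow> bool" where
  "recovery_rule \<omega> i \<longleftrightarrow> (\<omega> i \<longleftrightarrow> (\<forall>j. adj i j \<longrightarrow> \<not> \<omega> j))"

definition site_energy :: "real \<Rightarrow> config \<Rightarrow> site \<Rightarrow> real" where
  "site_energy \<beta> \<omega> i = (if recovery_rule \<omega> i then - \<beta> else \<beta>)"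

text \<open>The sum over all sites has only finitely many nonzero terms, since \<open>\<omega>\<close> and \<open>\<eta>\<close> differ at
  finitely many sites and the contribution of a site depends only on it and its four neighbours.\<close>

definition ground_state :: "real \<Rightarrow> config \<Rightarrow> bool" where
  "ground_state \<beta> \<eta> \<longleftrightarrow>
     (\<forall>\<omega>. finite {i. \<omega> i \<noteq> \<eta> i} \<longrightarrow>
        (\<Sum>\<^sub>\<infinity>i\<in>UNIV. site_energy \<beta> \<omega> i - site_energy \<beta> \<eta> i) \<ge> 0)"

text \<open>An element of \<open>{0,1}^\<Lambda>\<close> is represented by a function that is \<open>undefined\<close> outside \<open>\<Lambda>\<close>.\<close>

definition ground_restrictions :: "real \<Rightarrow> site set \<Rightarrow> config set" where
  "ground_restrictions \<beta> \<Lambda> = (\<lambda>\<eta>. restrict \<eta> \<Lambda>) ` {\<eta>. ground_state \<beta> \<eta>}"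

definition grid_box :: "nat \<Rightarrow> nat \<Rightarrow> site set" where
  "grid_box m n = {- int (m div 2)..int (m div 2)} \<times> {- int (n div 2)..int (n div 2)}"

definition box_entropy :: "real \<Rightarrow> nat \<Rightarrow> nat \<Rightarrow> real" where
  "box_entropy \<beta> m n =
     log 2 (real (card (ground_restrictions \<beta> (grid_box m n)))) / (real m * real n)"

text \<open>The limit is the joint one, with \<open>m\<close> and \<open>n\<close> tending to infinity independently. The
  operator \<open>Lim\<close> is meaningful only if the limit exists.\<close>

definition H0 :: "real \<Rightarrow> real" where
  "H0 \<beta> = Lim (sequentially \<times>\<^sub>F sequentially) (\<lambda>(m, n). box_entropy \<beta> m n)"

end

theory Submission
  imports Defs "HOL-Real_Asymp.Real_Asymp"
begin

text \<open>
  Ground states are exactly the maximal independent sets of the square lattice, because any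
  violation of the recovery rule can be repaired locally without creating a new one
  (\<open>ground_state_iff\<close>). The number of their patterns on a region is submultiplicative, so the
  entropy exists as a joint limit and equals \<open>bit_rate\<close>, the infimum of the bits per site over
  all rectangles (\<open>box_entropy_tendsto\<close>). Up to boundary effects, rectangles can be traded for
  parallelograms whose rows are pieces of antidiagonals, and it remains to count the sequences of
  such rows.

  Each site gets one of three states: occupied, covered from the previous row, or bare, that is,
  still to be covered by the next row. In terms of states, being a maximal independent set is a
  local condition on two consecutive rows, so rows form a transfer operator whose growth rate is the
  entropy. The rate is bounded from both sides by the Collatz-Wielandt principle: if a positive
  function \<open>V\<close> of rows satisfies that its sum over all successors of a row \<open>b\<close> is at most (at least)
  \<open>r * V b\<close>, then the number of sequences grows at most (at least) like the powers of \<open>r\<close>.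

  The row length is unbounded, so \<open>V\<close> has to be a product of local factors. With a product over
  windows of three consecutive states, the sum over successors can be done entry by entry, with
  an auxiliary weight for the five states around the kink between the finished part of the new
  row and the rest of the old one. One step of the kink multiplies the weights by a factor that
  depends on six states and the new one. The whole estimate thus reduces to finitely many
  integer inequalities: with suitable weights every step gains at most \<open>43 / 34\<close>
  (\<open>kink_certificate_upper\<close>), and with others at least \<open>21 / 17\<close> (\<open>kink_certificate_lower\<close>).
  These give \<open>7 / 23 \<le> bit_rate \<le> 17 / 50\<close>, which lies inside the claimed interval.

  The two bounds treat the ends of a row differently. For the upper bound every maximal
  independent set yields a sequence of rows, and some constraints at the ends are dropped. For the
  lower bound every sequence of rows has to be realised, so dead ends must be avoided: the kink
  weights vanish on them, and every bare site, also at the end of a row, is covered. The occupied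
  sites then extend to a maximal independent set that adds no site within the rows.
\<close>

section \<open>Ground states are the maximal independent sets\<close>

definition maximal_independent :: "config \<Rightarrow> bool" where
  "maximal_independent \<eta> \<longleftrightarrow> (\<forall>i. recovery_rule \<eta> i)"

lemma adj_iff:
  "adj (x, y) j \<longleftrightarrow> j \<in> {(x + 1, y), (x - 1, y), (x, y + 1), (x, y - 1)}"
  by (cases j) (auto simp: adj_def)

lemma adj_sym: "adj i j \<longleftrightarrow> adj j i"
  by (simp add: adj_def abs_minus_commute)

lemma adj_irrefl: "\<not> adj i i"
  by (simp add: adj_def)

lemma finite_neighbours: "finite {j. adj i j}"
  by (cases i) (simp add: adj_iff)

lemma recovery_rule_iff:
  "recovery_rule \<omega> (x, y) \<longleftrightarrow>
     (\<omega> (x, y) \<longleftrightarrow> \<not> \<omega> (x + 1, y) \<and> \<not> \<omega> (x - 1, y) \<and> \<not> \<omega> (x, y + 1) \<and> \<not> \<omega> (x, y - 1))"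
  by (auto simp: recovery_rule_def adj_iff)

text \<open>A violated site \<open>i\<close> is repaired by changes at \<open>i\<close> and its neighbours only. If \<open>i\<close> and all its
  neighbours are vacant, occupying \<open>i\<close> does no harm. Otherwise \<open>i\<close> and a neighbour are both
  occupied; \<open>i\<close> is vacated, and the neighbours that relied on \<open>i\<close> alone for their cover
  are occupied instead. These are vacant sites with vacant surroundings, and no two of them are
  adjacent because the lattice is bipartite.\<close>

lemma local_repair:
  assumes "\<not> recovery_rule \<eta> i"
  shows "\<exists>\<omega>. finite {j. \<omega> j \<noteq> \<eta> j} \<and> recovery_rule \<omega> i \<and>
             (\<forall>j. recovery_rule \<eta> j \<longrightarrow> recovery_rule \<omega> j)"
proof (cases "\<eta> i")
  case False
  then have nb: "\<not> \<eta> j" if "adj i j" for j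
    using assms that False unfolding recovery_rule_def by blast
  let ?\<omega> = "\<eta>(i := True)"
  have "finite {j. ?\<omega> j \<noteq> \<eta> j}"
    by (rule finite_subset[of _ "{i}"]) auto
  moreover have "recovery_rule ?\<omega> i"
    using nb adj_irrefl by (simp add: recovery_rule_def)
  moreover have "recovery_rule ?\<omega> j" if r: "recovery_rule \<eta> j" for j
  proof -
    have ji: "j \<noteq> i" using assms r by blast
    show ?thesis
    proof (cases "adj i j")
      case True
      then have "adj j i" "\<not> ?\<omega> j" using nb adj_sym ji by auto
      then show ?thesis unfolding recovery_rule_def by (metis fun_upd_same)
    next
      case False
      then have "k \<noteq> i" if "adj j k" for k using that adj_sym by blast
      then have "?\<omega> k = \<eta> k" if "adj j k" for k using that by simp
      then show ?thesis using r ji unfolding recovery_rule_def by auto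
    qed
  qed
  ultimately show ?thesis by blast
next
  case True
  define free where "free k \<longleftrightarrow> adj i k \<and> (\<forall>l. adj k l \<longrightarrow> l \<noteq> i \<longrightarrow> \<not> \<eta> l)" for k
  obtain k0 where k0: "adj i k0" "\<eta> k0"
    using True assms unfolding recovery_rule_def by blast
  \<comment> \<open>the sites \<open>k\<close> with \<open>free k\<close> lose their only cover when \<open>i\<close> is vacated\<close>
  define \<omega> where "\<omega> j \<longleftrightarrow> j \<noteq> i \<and> (\<eta> j \<or> free j)" for j
  have odd: "\<not> adj k l" if "adj i k" "adj i l" for k l
    using that by (cases i) (auto simp: adj_iff)
  have "finite {j. \<omega> j \<noteq> \<eta> j}"
    by (rule finite_subset[of _ "insert i {j. adj i j}"])
       (auto simp: \<omega>_def free_def finite_neighbours)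
  moreover have "recovery_rule \<omega> i"
    using k0 adj_irrefl unfolding recovery_rule_def \<omega>_def by blast
  moreover have "recovery_rule \<omega> j" if r: "recovery_rule \<eta> j" for j
  proof (cases "j = i")
    case True
    then show ?thesis using assms r by simp
  next
    case ji: False
    show ?thesis
    proof (cases "adj i j")
      case True
      then have "adj j i" using adj_sym by blast
      then have "\<not> \<eta> j" using r \<open>\<eta> i\<close> unfolding recovery_rule_def by blast
      have nofree: "\<not> free l" if "adj j l" for l
        using odd[OF True, of l] that by (auto simp: free_def)
      show ?thesis
      proof (cases "free j")
        case True
        then have "\<not> \<omega> l" if "adj j l" for l
          using nofree[OF that] that unfolding \<omega>_def free_def by blast
        moreover have "\<omega> j" using True ji by (simp add: \<omega>_def)
        ultimately show ?thesis unfolding recovery_rule_def by blast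
      next
        case False
        then obtain l where "adj j l" "l \<noteq> i" "\<eta> l"
          using \<open>adj i j\<close> unfolding free_def by blast
        moreover have "\<not> \<omega> j" using False \<open>\<not> \<eta> j\<close> by (simp add: \<omega>_def)
        ultimately show ?thesis unfolding recovery_rule_def \<omega>_def by blast
      qed
    next
      case False
      then have ni: "\<not> adj j i" using adj_sym by blast
      have same: "\<omega> j \<longleftrightarrow> \<eta> j" using False ji by (simp add: \<omega>_def free_def)
      have f: "\<not> \<eta> j" if "adj j l" "free l" for l
        using that ji adj_sym unfolding free_def by blast
      show ?thesis
      proof (cases "\<eta> j")
        case True
        then have "\<not> \<omega> l" if "adj j l" for l
          using that r f unfolding recovery_rule_def \<omega>_def by blast
        then show ?thesis using True same unfolding recovery_rule_def by blast
      next
        case False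
        then obtain l where "adj j l" "\<eta> l" using r unfolding recovery_rule_def by blast
        then have "\<omega> l" using ni unfolding \<omega>_def by blast
        then show ?thesis using False same \<open>adj j l\<close> unfolding recovery_rule_def by blast
      qed
    qed
  qed
  ultimately show ?thesis by blast
qed

text \<open>A local repair changes finitely many terms of the energy difference, none of them upwards and
  one of them strictly downwards, so a ground state cannot have a violation.\<close>

lemma ground_state_iff:
  assumes "\<beta> > 0"
  shows "ground_state \<beta> \<eta> \<longleftrightarrow> maximal_independent \<eta>"
proof
  assume m: "maximal_independent \<eta>"
  show "ground_state \<beta> \<eta>"
    unfolding ground_state_def
    using m assms by (auto intro!: infsum_nonneg simp: site_energy_def maximal_independent_def)
next
  assume g: "ground_state \<beta> \<eta>"
  show "maximal_independent \<eta>"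
  proof (rule ccontr)
    assume "\<not> maximal_independent \<eta>"
    then obtain i where "\<not> recovery_rule \<eta> i" by (auto simp: maximal_independent_def)
    then obtain \<omega> where fin: "finite {j. \<omega> j \<noteq> \<eta> j}" and i: "recovery_rule \<omega> i" "\<not> recovery_rule \<eta> i"
      and mono: "\<And>j. recovery_rule \<eta> j \<Longrightarrow> recovery_rule \<omega> j"
      using local_repair by blast
    define d where "d j = site_energy \<beta> \<omega> j - site_energy \<beta> \<eta> j" for j
    define D where "D = {j. \<omega> j \<noteq> \<eta> j}"
    define T where "T = insert i (D \<union> (\<Union>j\<in>D. {k. adj j k}))"
    have finT: "finite T"
      using fin finite_neighbours unfolding T_def D_def by blast
    have "d j = 0" if "j \<notin> T" for j
    proof -
      have "\<omega> j = \<eta> j" "\<And>k. adj j k \<Longrightarrow> \<omega> k = \<eta> k"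
        using that adj_sym unfolding T_def D_def by blast+
      then have "recovery_rule \<omega> j \<longleftrightarrow> recovery_rule \<eta> j"
        unfolding recovery_rule_def by metis
      then show ?thesis by (simp add: d_def site_energy_def)
    qed
    then have "infsum d UNIV = infsum d T"
      by (intro infsum_cong_neutral) auto
    also have "\<dots> = sum d T" using finT by simp
    also have "\<dots> < 0"
    proof -
      have "d j \<le> 0" for j using mono assms by (auto simp: d_def site_energy_def)
      moreover have "d i < 0" using i assms by (simp add: d_def site_energy_def)
      ultimately have "sum d T < sum (\<lambda>_. 0) T"
        using finT by (intro sum_strict_mono_ex1) (simp_all add: T_def)
      then show ?thesis by simp
    qed
    finally show False
      using g fin unfolding ground_state_def d_def by force
  qed
qed

section \<open>Counting patterns\<close>

definition patterns :: "site set \<Rightarrow> config set" where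
  "patterns \<Lambda> = (\<lambda>\<eta>. restrict \<eta> \<Lambda>) ` {\<eta>. maximal_independent \<eta>}"

lemma ground_restrictions_eq_patterns:
  "\<beta> > 0 \<Longrightarrow> ground_restrictions \<beta> \<Lambda> = patterns \<Lambda>"
  by (simp add: ground_restrictions_def patterns_def ground_state_iff)

text \<open>Patterns on a finite region become restrictions of ground states as soon as the vacant sites of
  the region are covered by an independent set, which Zorn's lemma completes.\<close>

lemma extend_to_maximal_independent:
  assumes indep: "\<And>i j. adj i j \<Longrightarrow> W i \<Longrightarrow> \<not> W j"
  obtains \<eta> where "maximal_independent \<eta>" "\<And>i. W i \<Longrightarrow> \<eta> i"
proof -
  define A where "A = {X. {i. W i} \<subseteq> X \<and> (\<forall>i\<in>X. \<forall>j\<in>X. \<not> adj i j)}"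
  have "\<exists>M\<in>A. \<forall>X\<in>A. M \<subseteq> X \<longrightarrow> X = M"
  proof (rule subset_Zorn_nonempty)
    show "A \<noteq> {}" using indep by (auto simp: A_def)
    fix C assume C: "C \<noteq> {}" "subset.chain A C"
    have "\<not> adj i j" if i: "i \<in> X" "X \<in> C" and j: "j \<in> Y" "Y \<in> C" for i j X Y
    proof -
      have "X \<subseteq> Y \<or> Y \<subseteq> X" using C i j by (auto simp: subset.chain_def)
      moreover have "X \<in> A" "Y \<in> A" using C i j by (auto simp: subset.chain_def)
      ultimately show ?thesis using i j unfolding A_def by blast
    qed
    moreover have "{i. W i} \<subseteq> \<Union>C" using C unfolding A_def subset.chain_def by blast
    ultimately show "\<Union>C \<in> A" unfolding A_def by blast
  qed
  then obtain M where M: "M \<in> A" and max: "\<And>X. X \<in> A \<Longrightarrow> M \<subseteq> X \<Longrightarrow> X = M" by blast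
  have "recovery_rule (\<lambda>i. i \<in> M) i" for i
  proof (cases "i \<in> M")
    case True
    then show ?thesis using M unfolding recovery_rule_def A_def by blast
  next
    case False
    then have "insert i M \<notin> A" using max by blast
    then have "\<exists>j\<in>M. adj i j"
      using M adj_sym[of i] adj_irrefl[of i] unfolding A_def by blast
    then show ?thesis using False unfolding recovery_rule_def by blast
  qed
  then show ?thesis
    using that[of "\<lambda>i. i \<in> M"] M by (auto simp: maximal_independent_def A_def)
qed

lemma finite_patterns: "finite \<Lambda> \<Longrightarrow> finite (patterns \<Lambda>)"
  by (rule finite_subset[of _ "\<Lambda> \<rightarrow>\<^sub>E UNIV"]) (simp_all add: patterns_def image_subset_iff finite_PiE)

lemma patterns_nonempty: "patterns \<Lambda> \<noteq> {}"
  using extend_to_maximal_independent[of "\<lambda>_. False"] unfolding patterns_def by blast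

lemma card_patterns_pos: "finite \<Lambda> \<Longrightarrow> card (patterns \<Lambda>) \<ge> 1"
  using finite_patterns patterns_nonempty by (simp add: Suc_le_eq card_gt_0_iff)

lemma card_patterns_mono:
  assumes "A \<subseteq> B" "finite B"
  shows "card (patterns A) \<le> card (patterns B)"
proof -
  have "patterns A \<subseteq> (\<lambda>p. restrict p A) ` patterns B"
    using assms(1) by (auto simp: patterns_def image_image restrict_restrict Int_absorb1)
  then show ?thesis using finite_patterns[OF assms(2)] by (rule surj_card_le[rotated])
qed

lemma card_patterns_Un:
  assumes "finite A" "finite B"
  shows "card (patterns (A \<union> B)) \<le> card (patterns A) * card (patterns B)"
proof -
  let ?f = "\<lambda>(p, q) i. if i \<in> A then p i else q i"
  have "patterns (A \<union> B) \<subseteq> ?f ` (patterns A \<times> patterns B)"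
  proof
    fix p assume "p \<in> patterns (A \<union> B)"
    then obtain \<eta> where \<eta>: "maximal_independent \<eta>" "p = restrict \<eta> (A \<union> B)"
      by (auto simp: patterns_def)
    then have "p = ?f (restrict \<eta> A, restrict \<eta> B)" by auto
    with \<eta> show "p \<in> ?f ` (patterns A \<times> patterns B)"
      unfolding patterns_def by blast
  qed
  then show ?thesis
    using surj_card_le[of "patterns A \<times> patterns B"] assms by (simp add: card_cartesian_product finite_patterns)
qed

lemma maximal_independent_translate:
  assumes "maximal_independent \<eta>"
  shows "maximal_independent (\<lambda>i. \<eta> (i + v))"
  unfolding maximal_independent_def
proof
  fix i
  have adj: "adj (i + v) (j + v) \<longleftrightarrow> adj i j" for j by (simp add: adj_def)
  have "(\<forall>j. adj i j \<longrightarrow> \<not> \<eta> (j + v)) \<longleftrightarrow> (\<forall>j. adj (i + v) j \<longrightarrow> \<not> \<eta> j)"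
    (is "?L \<longleftrightarrow> ?R")
  proof
    assume L: ?L
    show ?R
    proof (intro allI impI)
      fix j assume "adj (i + v) j"
      then show "\<not> \<eta> j" using L[rule_format, of "j - v"] adj[of "j - v"] by simp
    qed
  next
    assume ?R
    then show ?L using adj by blast
  qed
  moreover have "recovery_rule \<eta> (i + v)"
    using assms unfolding maximal_independent_def by blast
  ultimately show "recovery_rule (\<lambda>i. \<eta> (i + v)) i"
    unfolding recovery_rule_def by blast
qed

lemma card_patterns_translate:
  assumes "finite A"
  shows "card (patterns ((+) v ` A)) = card (patterns A)"
proof -
  have le: "card (patterns ((+) v ` A)) \<le> card (patterns A)" if "finite A" for v A
  proof -
    let ?f = "\<lambda>p i. if i \<in> (+) v ` A then p (i - v) else undefined"
    have "patterns ((+) v ` A) \<subseteq> ?f ` patterns A"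
    proof
      fix p assume "p \<in> patterns ((+) v ` A)"
      then obtain \<eta> where \<eta>: "maximal_independent \<eta>" "p = restrict \<eta> ((+) v ` A)"
        by (auto simp: patterns_def)
      then have "p = ?f (restrict (\<lambda>i. \<eta> (i + v)) A)" by (auto simp: fun_eq_iff)
      then show "p \<in> ?f ` patterns A"
        using maximal_independent_translate[OF \<eta>(1)] unfolding patterns_def by blast
    qed
    then show ?thesis using finite_patterns[OF that] by (rule surj_card_le[rotated])
  qed
  have "(+) (- v) ` (+) v ` A = A" by (auto simp: image_image)
  then show ?thesis
    using le[OF assms, of v] le[of "(+) v ` A" "- v"] assms by simp
qed

section \<open>The entropy as the infimum over rectangles\<close>

text \<open>Restricting to two pieces of a region loses nothing, so the number of bits \<open>rect_bits\<close>
  is subadditive in both side lengths. As in Fekete's lemma, the rate per site then converges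
  to its infimum over all rectangles.\<close>

definition rect :: "nat \<Rightarrow> nat \<Rightarrow> site set" where
  "rect a b = {0..<int a} \<times> {0..<int b}"

definition rect_bits :: "nat \<Rightarrow> nat \<Rightarrow> real" where
  "rect_bits a b = log 2 (real (card (patterns (rect a b))))"

definition bit_rate :: real where
  "bit_rate = (INF (a, b)\<in>{1..} \<times> {1..}. rect_bits a b / (real a * real b))"

lemma finite_rect [simp]: "finite (rect a b)"
  by (simp add: rect_def)

lemma rect_bits_nonneg: "rect_bits a b \<ge> 0"
  using card_patterns_pos[of "rect a b"] by (simp add: rect_bits_def)

lemma log_card_patterns_mono:
  assumes "A \<subseteq> B" "finite B"
  shows "log 2 (real (card (patterns A))) \<le> log 2 (real (card (patterns B)))"
proof -
  have "1 \<le> card (patterns A)" using assms card_patterns_pos finite_subset by blast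
  then show ?thesis using card_patterns_mono[OF assms] by simp
qed

lemma rect_bits_mono: "a \<le> a' \<Longrightarrow> b \<le> b' \<Longrightarrow> rect_bits a b \<le> rect_bits a' b'"
  unfolding rect_bits_def by (rule log_card_patterns_mono) (auto simp: rect_def)

lemma log_card_patterns_Un:
  assumes "finite A" "finite B"
  shows "log 2 (real (card (patterns (A \<union> B)))) \<le>
         log 2 (real (card (patterns A))) + log 2 (real (card (patterns B)))"
proof -
  have pos: "1 \<le> card (patterns A)" "1 \<le> card (patterns B)" "1 \<le> card (patterns (A \<union> B))"
    using assms card_patterns_pos by blast+
  have "log 2 (real (card (patterns (A \<union> B)))) \<le> log 2 (real (card (patterns A)) * real (card (patterns B)))"
    using card_patterns_Un[OF assms] pos
    by (intro log_mono) (auto simp flip: of_nat_mult)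
  also have "\<dots> = log 2 (real (card (patterns A))) + log 2 (real (card (patterns B)))"
    using pos by (simp add: log_mult)
  finally show ?thesis .
qed

lemma rect_bits_add_left: "rect_bits (a + a') b \<le> rect_bits a b + rect_bits a' b"
proof -
  have "rect (a + a') b = rect a b \<union> (+) (int a, 0) ` rect a' b"
  proof (intro equalityI subsetI)
    fix i assume i: "i \<in> rect (a + a') b"
    show "i \<in> rect a b \<union> (+) (int a, 0) ` rect a' b"
    proof (cases "fst i < int a")
      case False
      then have "i - (int a, 0) \<in> rect a' b" using i by (auto simp: rect_def)
      then show ?thesis by (metis UnI2 diff_add_cancel image_eqI add.commute)
    qed (use i in \<open>auto simp: rect_def\<close>)
  qed (auto simp: rect_def)
  then show ?thesis
    using log_card_patterns_Un[of "rect a b" "(+) (int a, 0) ` rect a' b"]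
    by (simp add: rect_bits_def card_patterns_translate)
qed

lemma rect_bits_add_right: "rect_bits a (b + b') \<le> rect_bits a b + rect_bits a b'"
proof -
  have "rect a (b + b') = rect a b \<union> (+) (0, int b) ` rect a b'"
  proof (intro equalityI subsetI)
    fix i assume i: "i \<in> rect a (b + b')"
    show "i \<in> rect a b \<union> (+) (0, int b) ` rect a b'"
    proof (cases "snd i < int b")
      case False
      then have "i - (0, int b) \<in> rect a b'" using i by (auto simp: rect_def)
      then show ?thesis by (metis UnI2 diff_add_cancel image_eqI add.commute)
    qed (use i in \<open>auto simp: rect_def\<close>)
  qed (auto simp: rect_def)
  then show ?thesis
    using log_card_patterns_Un[of "rect a b" "(+) (0, int b) ` rect a b'"]
    by (simp add: rect_bits_def card_patterns_translate)
qed

lemma rect_bits_zero [simp]: "rect_bits 0 b = 0" "rect_bits a 0 = 0"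
proof -
  have "card (patterns {}) = 1"
  proof -
    have "patterns {} \<subseteq> {\<lambda>_. undefined}" by (auto simp: patterns_def)
    then have "patterns {} = {\<lambda>_. undefined}" using patterns_nonempty by blast
    then show ?thesis by simp
  qed
  then show "rect_bits 0 b = 0" "rect_bits a 0 = 0" by (simp_all add: rect_bits_def rect_def)
qed

lemma rect_bits_mult: "rect_bits (k * a) (l * b) \<le> real k * real l * rect_bits a b"
proof -
  have left: "rect_bits (k * a) b' \<le> real k * rect_bits a b'" for b'
  proof (induction k)
    case (Suc k)
    have "rect_bits (Suc k * a) b' \<le> rect_bits a b' + rect_bits (k * a) b'"
      using rect_bits_add_left[of a "k * a" b'] by simp
    with Suc show ?case by (simp add: algebra_simps)
  qed simp
  have right: "rect_bits a (l * b) \<le> real l * rect_bits a b"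
  proof (induction l)
    case (Suc l)
    have "rect_bits a (Suc l * b) \<le> rect_bits a b + rect_bits a (l * b)"
      using rect_bits_add_right[of a b "l * b"] by simp
    with Suc show ?case by (simp add: algebra_simps)
  qed simp
  have "rect_bits (k * a) (l * b) \<le> real k * rect_bits a (l * b)" by (rule left)
  also have "\<dots> \<le> real k * (real l * rect_bits a b)" by (intro mult_left_mono right) simp
  finally show ?thesis by (simp add: mult.assoc)
qed

lemma rect_bits_cover:
  assumes "a \<ge> 1" "b \<ge> 1"
  shows "rect_bits m n \<le> (real m / real a + 1) * (real n / real b + 1) * rect_bits a b"
proof -
  have le: "m \<le> (m div a + 1) * a" if "a \<ge> 1" for m a :: nat
    using that by (metis Suc_eq_plus1 dividend_less_div_times less_imp_le_nat less_le_trans mult_Suc zero_less_one add.commute)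
  have r: "real (m div a + 1) \<le> real m / real a + 1" for m a :: nat
    by (simp add: of_nat_div_le_of_nat)
  \<comment> \<open>cover the rectangle by copies of the \<open>a\<close> by \<open>b\<close> rectangle, rounding up\<close>
  have "rect_bits m n \<le> rect_bits ((m div a + 1) * a) ((n div b + 1) * b)"
    by (intro rect_bits_mono le assms)
  also have "\<dots> \<le> real (m div a + 1) * real (n div b + 1) * rect_bits a b"
    by (rule rect_bits_mult)
  also have "\<dots> \<le> (real m / real a + 1) * (real n / real b + 1) * rect_bits a b"
    by (intro mult_right_mono mult_mono r rect_bits_nonneg) auto
  finally show ?thesis .
qed

lemma bit_rate_le:
  assumes "a \<ge> 1" "b \<ge> 1"
  shows "bit_rate \<le> rect_bits a b / (real a * real b)"
proof -
  have "bdd_below ((\<lambda>(a, b). rect_bits a b / (real a * real b)) ` ({1..} \<times> {1..}))"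
    by (intro bdd_belowI[of _ 0]) (auto simp: rect_bits_nonneg)
  then show ?thesis
    unfolding bit_rate_def using assms
    by (intro cINF_lower2[of _ _ "(a, b)"]) auto
qed

lemma bit_rate_mult_le: "bit_rate * (real a * real b) \<le> rect_bits a b"
proof (cases "a = 0 \<or> b = 0")
  case False
  then show ?thesis using bit_rate_le[of a b] by (simp add: field_simps)
qed auto

lemma bit_rate_greatest:
  assumes "\<And>a b. a \<ge> 1 \<Longrightarrow> b \<ge> 1 \<Longrightarrow> x \<le> rect_bits a b / (real a * real b)"
  shows "x \<le> bit_rate"
  unfolding bit_rate_def by (rule cINF_greatest) (use assms in auto)

lemma log_card_grid_box:
  "log 2 (real (card (patterns (grid_box m n)))) = rect_bits (2 * (m div 2) + 1) (2 * (n div 2) + 1)"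
proof -
  let ?v = "(- int (m div 2), - int (n div 2))"
  have "grid_box m n = (+) ?v ` rect (2 * (m div 2) + 1) (2 * (n div 2) + 1)" (is "_ = (+) ?v ` ?R")
  proof (intro equalityI subsetI)
    fix i assume "i \<in> grid_box m n"
    then have "i - ?v \<in> ?R" by (auto simp: grid_box_def rect_def)
    then show "i \<in> (+) ?v ` ?R" by (metis diff_add_cancel image_eqI add.commute)
  qed (auto simp: grid_box_def rect_def)
  then show ?thesis by (simp add: rect_bits_def card_patterns_translate)
qed

lemma box_entropy_bounds:
  assumes "\<beta> > 0" "m \<ge> 1" "n \<ge> 1"
  shows "bit_rate \<le> box_entropy \<beta> m n"
    and "a \<ge> 1 \<Longrightarrow> b \<ge> 1 \<Longrightarrow> box_entropy \<beta> m n \<le>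
           ((real m + 1) / real a + 1) * ((real n + 1) / real b + 1) * rect_bits a b / (real m * real n)"
proof -
  have eq: "box_entropy \<beta> m n = rect_bits (2 * (m div 2) + 1) (2 * (n div 2) + 1) / (real m * real n)"
    using assms by (simp add: box_entropy_def ground_restrictions_eq_patterns log_card_grid_box)
  have "bit_rate * (real m * real n) \<le> rect_bits (2 * (m div 2) + 1) (2 * (n div 2) + 1)"
    by (rule order_trans[OF bit_rate_mult_le rect_bits_mono]) linarith+
  then show "bit_rate \<le> box_entropy \<beta> m n"
    using assms by (simp add: eq field_simps)
  assume ab: "a \<ge> 1" "b \<ge> 1"
  have "rect_bits (2 * (m div 2) + 1) (2 * (n div 2) + 1) \<le> rect_bits (m + 1) (n + 1)"
    by (intro rect_bits_mono) linarith+
  also have "\<dots> \<le> ((real m + 1) / real a + 1) * ((real n + 1) / real b + 1) * rect_bits a b"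
    using rect_bits_cover[OF ab, of "m + 1" "n + 1"] by (simp add: add_ac)
  finally show "box_entropy \<beta> m n \<le>
           ((real m + 1) / real a + 1) * ((real n + 1) / real b + 1) * rect_bits a b / (real m * real n)"
    unfolding eq by (rule divide_right_mono) simp
qed

lemma box_entropy_tendsto:
  assumes "\<beta> > 0"
  shows "((\<lambda>(m, n). box_entropy \<beta> m n) \<longlongrightarrow> bit_rate) (sequentially \<times>\<^sub>F sequentially)"
proof (rule order_tendstoI)
  fix x assume "x < bit_rate"
  moreover have "\<forall>\<^sub>F z in sequentially \<times>\<^sub>F sequentially. fst z \<ge> 1 \<and> snd z \<ge> (1 :: nat)"
    by (auto simp: eventually_prod_sequentially)
  ultimately show "\<forall>\<^sub>F z in sequentially \<times>\<^sub>F sequentially. x < (\<lambda>(m, n). box_entropy \<beta> m n) z"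
    by (elim eventually_mono) (use box_entropy_bounds(1)[OF assms] in \<open>force simp: split_beta\<close>)
next
  fix x assume x: "bit_rate < x"
  then obtain a b where ab: "a \<ge> 1" "b \<ge> 1" and less: "rect_bits a b / (real a * real b) < x"
    using bit_rate_greatest[of x] by (meson not_less)
  define f where "f c m = ((real m + 1) / real c + 1) / real m" for c m :: nat
  have f: "f c \<longlonglongrightarrow> inverse (real c)" if "c \<ge> 1" for c
    unfolding f_def using that by real_asymp
  have "((\<lambda>z. f a (fst z) * f b (snd z) * rect_bits a b) \<longlongrightarrow> inverse (real a) * inverse (real b) * rect_bits a b)
          (sequentially \<times>\<^sub>F sequentially)"
    by (intro tendsto_mult tendsto_const filterlim_compose[OF f[OF ab(1)] filterlim_fst]
          filterlim_compose[OF f[OF ab(2)] filterlim_snd])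
  then have "\<forall>\<^sub>F z in sequentially \<times>\<^sub>F sequentially. f a (fst z) * f b (snd z) * rect_bits a b < x"
    using less by (intro order_tendstoD(2)) (auto simp: field_simps)
  moreover have "\<forall>\<^sub>F z in sequentially \<times>\<^sub>F sequentially. fst z \<ge> 1 \<and> snd z \<ge> (1 :: nat)"
    by (auto simp: eventually_prod_sequentially)
  ultimately show "\<forall>\<^sub>F z in sequentially \<times>\<^sub>F sequentially. (\<lambda>(m, n). box_entropy \<beta> m n) z < x"
  proof eventually_elim
    case (elim z)
    then have "box_entropy \<beta> (fst z) (snd z) \<le> f a (fst z) * f b (snd z) * rect_bits a b"
      using box_entropy_bounds(2)[OF assms _ _ ab, of "fst z" "snd z"] by (simp add: f_def field_simps)
    with elim show ?case by (simp add: split_beta)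
  qed
qed

lemma H0_eq_bit_rate: "\<beta> > 0 \<Longrightarrow> H0 \<beta> = bit_rate"
  unfolding H0_def by (rule tendsto_Lim[OF _ box_entropy_tendsto]) (simp_all add: prod_filter_eq_bot)

section \<open>Bounding the entropy through parallelograms\<close>

text \<open>Site \<open>slant d j\<close> is entry \<open>j\<close> of the antidiagonal \<open>d\<close>. Two neighbouring sites
  lie on consecutive antidiagonals: the neighbours of entry \<open>j\<close> are the entries \<open>j - 1\<close>
  and \<open>j\<close> of antidiagonal \<open>d - 1\<close> (its parents) and the entries \<open>j\<close> and \<open>j + 1\<close> of
  antidiagonal \<open>d + 1\<close> (its children). Sites of one antidiagonal are never adjacent, which
  makes antidiagonals better rows for a transfer operator than horizontal lines.\<close>

definition slant :: "nat \<Rightarrow> nat \<Rightarrow> site" where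
  "slant d j = (int d - int j, int j)"

definition parallelogram :: "nat \<Rightarrow> nat \<Rightarrow> site set" where
  "parallelogram m n = (\<lambda>(d, j). slant d j) ` ({..<n} \<times> {..<m})"

lemma finite_parallelogram [simp]: "finite (parallelogram m n)"
  by (simp add: parallelogram_def)

lemma mult_bounded_imp_nonpos:
  fixes x C :: real
  assumes "\<And>n :: nat. real n * x \<le> C"
  shows "x \<le> 0"
proof (rule ccontr)
  assume "\<not> x \<le> 0"
  then have "x > 0" by simp
  then obtain n :: nat where "C < real n * x" using reals_Archimedean3 by blast
  then show False using assms[of n] by simp
qed

text \<open>Letting first the length \<open>n\<close> and then the width \<open>m\<close> of a parallelogram grow amounts to
  comparing slopes of affine functions twice.\<close>

lemma affine_le_imp_slope_le:
  fixes a b c e :: real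
  assumes "\<And>n :: nat. real n * a + c \<le> real n * b + e"
  shows "a \<le> b"
  using mult_bounded_imp_nonpos[of "a - b" "e - c"] assms by (simp add: algebra_simps)

lemma affine_le_imp_slope_le':
  fixes a b c e :: real
  assumes "\<And>n :: nat. n \<ge> k \<Longrightarrow> real n * a + c \<le> real n * b + e"
  shows "a \<le> b"
proof (rule affine_le_imp_slope_le)
  fix n :: nat
  show "real n * a + (c + real k * a) \<le> real n * b + (e + real k * b)"
    using assms[of "n + k"] by (simp add: algebra_simps)
qed

text \<open>A parallelogram of width \<open>m\<close> and a rectangle of height \<open>m\<close> differ by two triangles, whose
  area does not depend on the length. The constants \<open>K\<close> and \<open>c\<close> absorb all boundary
  effects, since they contribute \<open>O(m + n)\<close> bits only.\<close>

lemma bit_rate_le_logI: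
  assumes pos: "K > 0" "c > 0" "x > 0"
    and le: "\<And>m n. m \<ge> k \<Longrightarrow> real (card (patterns (parallelogram m (Suc n)))) \<le> K ^ m * (c * x ^ m) ^ n"
  shows "bit_rate \<le> log 2 x"
proof (rule affine_le_imp_slope_le'[of k])
  fix m assume m: "k \<le> m"
  show "real m * bit_rate + 0 \<le> real m * log 2 x + log 2 c"
  proof (rule affine_le_imp_slope_le)
    fix n
    have "rect n m \<subseteq> parallelogram m (Suc (n + m))"
    proof
      fix i assume "i \<in> rect n m"
      then have "i = slant (nat (fst i + snd i)) (nat (snd i))"
        "nat (fst i + snd i) < Suc (n + m)" "nat (snd i) < m"
        by (auto simp: rect_def slant_def)
      then show "i \<in> parallelogram m (Suc (n + m))"
        unfolding parallelogram_def by force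
    qed
    then have "rect_bits n m \<le> log 2 (card (patterns (parallelogram m (Suc (n + m)))))"
      unfolding rect_bits_def by (rule log_card_patterns_mono) simp
    also have "\<dots> \<le> log 2 (K ^ m * (c * x ^ m) ^ (n + m))"
      using le[OF m, of "n + m"] card_patterns_pos[of "parallelogram m (Suc (n + m))"] pos
      by (intro log_mono) auto
    also have "\<dots> = real m * log 2 K + real (n + m) * (log 2 c + real m * log 2 x)"
      using pos by (simp add: log_mult log_nat_power)
    finally show "real n * (real m * bit_rate + 0) + 0 \<le>
        real n * (real m * log 2 x + log 2 c) + (real m * log 2 K + real m * (log 2 c + real m * log 2 x))"
      using bit_rate_mult_le[of n m] by (simp add: algebra_simps)
  qed
qed

lemma log_le_bit_rateI:
  assumes pos: "K > 0" "c > 0" "x > 0"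
    and le: "\<And>m n. m \<ge> k \<Longrightarrow> (c * x ^ m) ^ n \<le> real (card (patterns (parallelogram m (Suc n)))) * K ^ m"
  shows "log 2 x \<le> bit_rate"
proof (rule bit_rate_greatest)
  fix a b :: nat assume ab: "a \<ge> 1" "b \<ge> 1"
  define L where "L = rect_bits a b"
  show "log 2 x \<le> rect_bits a b / (real a * real b)"
  proof (rule affine_le_imp_slope_le'[of k])
    fix m assume m: "k \<le> m"
    show "real m * log 2 x + log 2 c \<le> real m * (rect_bits a b / (real a * real b)) + L / real a"
    proof (rule affine_le_imp_slope_le)
      fix n
      have "parallelogram m (Suc n) \<subseteq> (+) (- int m, 0) ` rect (n + m + 1) m"
      proof
        fix i assume "i \<in> parallelogram m (Suc n)"
        then have "i - (- int m, 0) \<in> rect (n + m + 1) m"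
          by (auto simp: rect_def slant_def parallelogram_def)
        then show "i \<in> (+) (- int m, 0) ` rect (n + m + 1) m"
          by (metis diff_add_cancel image_eqI add.commute)
      qed
      then have "log 2 (card (patterns (parallelogram m (Suc n)))) \<le>
          log 2 (card (patterns ((+) (- int m, 0) ` rect (n + m + 1) m)))"
        by (rule log_card_patterns_mono) simp
      also have "\<dots> = rect_bits (n + m + 1) m"
        by (simp add: rect_bits_def card_patterns_translate)
      also have "\<dots> \<le> (real (n + m + 1) / real a + 1) * (real m / real b + 1) * L"
        unfolding L_def by (rule rect_bits_cover[OF ab])
      finally have "log 2 (card (patterns (parallelogram m (Suc n)))) \<le> \<dots>" .
      moreover have "real n * (log 2 c + real m * log 2 x) \<le>
          log 2 (card (patterns (parallelogram m (Suc n)))) + real m * log 2 K"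
      proof -
        have "real n * (log 2 c + real m * log 2 x) = log 2 ((c * x ^ m) ^ n)"
          using pos by (simp add: log_mult log_nat_power)
        also have "\<dots> \<le> log 2 (real (card (patterns (parallelogram m (Suc n)))) * K ^ m)"
          using le[OF m, of n] pos by (intro log_mono) auto
        also have "\<dots> = log 2 (card (patterns (parallelogram m (Suc n)))) + real m * log 2 K"
          using pos card_patterns_pos[of "parallelogram m (Suc n)"] by (simp add: log_mult log_nat_power)
        finally show ?thesis .
      qed
      moreover have "(real (n + m + 1) / real a + 1) * (real m / real b + 1) * L =
          real n * (real m * (L / (real a * real b)) + L / real a) +
          (real (m + 1) / real a + 1) * (real m / real b + 1) * L"
        by (simp add: algebra_simps add_divide_distrib)
      moreover have "real n * (log 2 c + real m * log 2 x) = real n * (real m * log 2 x + log 2 c)"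
        by (simp add: add.commute)
      ultimately show "real n * (real m * log 2 x + log 2 c) + 0 \<le>
          real n * (real m * (rect_bits a b / (real a * real b)) + L / real a) +
          ((real (m + 1) / real a + 1) * (real m / real b + 1) * L + real m * log 2 K)"
        unfolding L_def[symmetric] by linarith
    qed
  qed
qed

section \<open>Counting paths by weights\<close>

text \<open>\<open>paths s n b\<close> are the sequences of \<open>n\<close> further rows that may follow \<open>b\<close>. A weight \<open>V\<close> that the
  successor sums multiply by at most (at least) \<open>r\<close> bounds their number by powers of \<open>r\<close>; this
  is the Collatz-Wielandt bound for the spectral radius of a nonnegative matrix, with \<open>V\<close> as
  test vector.\<close>

fun paths :: "('r \<Rightarrow> 'r set) \<Rightarrow> nat \<Rightarrow> 'r \<Rightarrow> 'r list set" where
  "paths s 0 b = {[]}"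
| "paths s (Suc n) b = (\<Union>a\<in>s b. (#) a ` paths s n a)"

lemma finite_paths: "(\<And>b. finite (s b)) \<Longrightarrow> finite (paths s n b)"
  by (induction n arbitrary: b) auto

lemma card_paths_Suc:
  assumes "\<And>b. finite (s b)"
  shows "card (paths s (Suc n) b) = (\<Sum>a\<in>s b. card (paths s n a))"
proof -
  have "card (paths s (Suc n) b) = (\<Sum>a\<in>s b. card ((#) a ` paths s n a))"
    unfolding paths.simps using assms finite_paths[OF assms] by (intro card_UN_disjoint) auto
  then show ?thesis by (simp add: card_image)
qed

lemma card_paths_le:
  fixes V :: "'r \<Rightarrow> real"
  assumes fin: "\<And>b. finite (s b)" and sub: "\<And>b. b \<in> X \<Longrightarrow> s b \<subseteq> X"
    and sup: "\<And>b. b \<in> X \<Longrightarrow> (\<Sum>a\<in>s b. V a) \<le> r * V b"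
    and low: "\<And>b. b \<in> X \<Longrightarrow> 1 \<le> V b" and r: "0 \<le> r" and b: "b \<in> X"
  shows "real (card (paths s n b)) \<le> r ^ n * V b"
  using b
proof (induction n arbitrary: b)
  case 0
  then show ?case using low by simp
next
  case (Suc n)
  have "real (card (paths s (Suc n) b)) = (\<Sum>a\<in>s b. real (card (paths s n a)))"
    using card_paths_Suc[of s n b, OF fin] by (simp del: paths.simps)
  also have "\<dots> \<le> (\<Sum>a\<in>s b. r ^ n * V a)"
    using Suc sub by (intro sum_mono) blast
  also have "\<dots> = r ^ n * (\<Sum>a\<in>s b. V a)" by (simp add: sum_distrib_left)
  also have "\<dots> \<le> r ^ n * (r * V b)"
    using Suc.prems r sup by (intro mult_left_mono) auto
  finally show ?case by (simp add: mult_ac)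
qed

lemma card_paths_ge:
  fixes V :: "'r \<Rightarrow> real"
  assumes fin: "\<And>b. finite (s b)" and sub: "\<And>b. b \<in> X \<Longrightarrow> s b \<subseteq> X"
    and sup: "\<And>b. b \<in> X \<Longrightarrow> r * V b \<le> (\<Sum>a\<in>s b. V a)"
    and high: "\<And>b. b \<in> X \<Longrightarrow> V b \<le> M" and r: "0 \<le> r" and b: "b \<in> X"
  shows "r ^ n * V b \<le> real (card (paths s n b)) * M"
  using b
proof (induction n arbitrary: b)
  case 0
  then show ?case using high by simp
next
  case (Suc n)
  have "r ^ Suc n * V b = r ^ n * (r * V b)" by (simp add: mult_ac)
  also have "\<dots> \<le> r ^ n * (\<Sum>a\<in>s b. V a)"
    using Suc.prems r sup by (intro mult_left_mono) auto
  also have "\<dots> = (\<Sum>a\<in>s b. r ^ n * V a)" by (simp add: sum_distrib_left)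
  also have "\<dots> \<le> (\<Sum>a\<in>s b. real (card (paths s n a)) * M)"
    using Suc sub by (intro sum_mono) blast
  also have "\<dots> = real (card (paths s (Suc n) b)) * M"
    using card_paths_Suc[of s n b, OF fin] by (simp add: sum_distrib_right del: paths.simps)
  finally show ?case .
qed

text \<open>The last row of a finite path is realised by a maximal independent set only if its bare sites
  get covered later, so paths are prolonged indefinitely.\<close>

lemma path_extends_to_chain:
  assumes ne: "\<And>b. b \<in> X \<Longrightarrow> s b \<noteq> {}" and sub: "\<And>b. b \<in> X \<Longrightarrow> s b \<subseteq> X"
    and b: "b \<in> X" and p: "p \<in> paths s n b"
  shows "\<exists>r. r 0 = b \<and> (\<forall>d. r (Suc d) \<in> s (r d)) \<and> p = map r [1..<Suc n]"
  using b p
proof (induction n arbitrary: b p)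
  case 0
  define r where "r = rec_nat b (\<lambda>_ c. SOME a. a \<in> s c)"
  have r: "r 0 = b" "\<And>d. r (Suc d) = (SOME a. a \<in> s (r d))" by (simp_all add: r_def)
  have some: "(SOME a. a \<in> s c) \<in> s c" if "c \<in> X" for c
    using ne[OF that] by (simp add: some_in_eq)
  have "r d \<in> X" for d
    by (induction d) (use r 0 some sub in auto)
  then have "r (Suc d) \<in> s (r d)" for d using some r by metis
  then show ?case using r 0 by (intro exI[of _ r]) auto
next
  case (Suc n)
  then obtain a q where a: "a \<in> s b" and q: "q \<in> paths s n a" and p: "p = a # q" by auto
  obtain r where r: "r 0 = a" "\<forall>d. r (Suc d) \<in> s (r d)" "q = map r [1..<Suc n]"
    using Suc.IH[of a q] a q Suc.prems(1) sub by blast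
  define r' where "r' = case_nat b r"
  have "map r' [1..<Suc (Suc n)] = map r [0..<Suc n]"
    by (rule nth_equalityI) (auto simp: r'_def nth_append simp del: upt_Suc)
  also have "\<dots> = p" using r p by (simp add: upt_rec[of 0] del: upt_Suc)
  finally have "p = map r' [1..<Suc (Suc n)]" by simp
  moreover have "r' (Suc d) \<in> s (r' d)" for d
    using a r by (cases d) (auto simp: r'_def)
  ultimately show ?case by (intro exI[of _ r']) (simp add: r'_def)
qed

section \<open>Rows of cells and their weights\<close>

text \<open>The state of a site relative to the rows already read: occupied, vacant with an occupied parent,
  or vacant without one. A bare site must be covered by one of its children.\<close>

datatype cell = Bare | Cov | Occ

lemma UNIV_cell: "(UNIV :: cell set) = {Bare, Cov, Occ}"
  using cell.exhaust by auto

lemma all_cell: "(\<forall>x. P x) \<longleftrightarrow> P Bare \<and> P Cov \<and> P Occ"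
  by (metis cell.exhaust)

lemma ex_cell: "(\<exists>x. P x) \<longleftrightarrow> P Bare \<or> P Cov \<or> P Occ"
  by (metis cell.exhaust)

instance cell :: finite
  by standard (simp add: UNIV_cell)

lemma cell_eqI: "(x = Occ \<longleftrightarrow> y = Occ) \<Longrightarrow> (x = Cov \<longleftrightarrow> y = Cov) \<Longrightarrow> x = y"
  by (cases x; cases y) auto

text \<open>Whether \<open>x\<close> may be entry \<open>j\<close> of a row, given its parents \<open>b\<close> (entry \<open>j - 1\<close>) and
  \<open>b'\<close> (entry \<open>j\<close>) and its left neighbour \<open>p\<close> in the new row. The second conjunct says that
  the parent \<open>b\<close>, if bare, is covered now at the latest, as \<open>p\<close> and \<open>x\<close> are its children.\<close>

definition allowed :: "cell \<Rightarrow> cell \<Rightarrow> cell \<Rightarrow> cell \<Rightarrow> bool" where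
  "allowed p b b' x \<longleftrightarrow>
     (x = Cov \<longleftrightarrow> b = Occ \<or> b' = Occ) \<and> (b = Bare \<and> p \<noteq> Occ \<longrightarrow> x = Occ)"

text \<open>The ways to continue a new row that has reached the entry \<open>p\<close>, over the remaining old row
  \<open>bs\<close>. The last old entry has one child inside the row and one beyond its end. With \<open>e\<close>
  set, it may stay uncovered inside only if its inner child is covered: the site beyond the end
  can then be occupied, and two such sites are never adjacent.\<close>

fun fills :: "bool \<Rightarrow> cell \<Rightarrow> cell list \<Rightarrow> cell list set" where
  "fills e p [] = {}"
| "fills e p [b] = (if e \<and> b = Bare \<and> p = Bare then {} else {[]})"
| "fills e p (b # b' # bs) = (\<Union>x\<in>{x. allowed p b b' x}. (#) x ` fills e x (b' # bs))"

lemma fills_iff: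
  "bs \<noteq> [] \<Longrightarrow> xs \<in> fills e p bs \<longleftrightarrow>
     Suc (length xs) = length bs \<and>
     (\<forall>i<length xs. allowed ((p # xs) ! i) (bs ! i) (bs ! Suc i) (xs ! i)) \<and>
     \<not> (e \<and> last bs = Bare \<and> last (p # xs) = Bare)"
proof (induction e p bs arbitrary: xs rule: fills.induct)
  case (3 e p b b' bs)
  show ?case
  proof (cases xs)
    case (Cons x ys)
    have "xs \<in> fills e p (b # b' # bs) \<longleftrightarrow> allowed p b b' x \<and> ys \<in> fills e x (b' # bs)"
      using Cons by auto
    then show ?thesis
      using "3.IH"[of x ys] Cons by (auto simp: All_less_Suc2)
  qed auto
qed auto

lemma finite_fills [simp]: "finite (fills e p bs)"
  by (induction e p bs rule: fills.induct) auto

text \<open>The test vector is a product of local factors over the windows of three consecutive entries.\<close>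

fun row_weight :: "(cell \<Rightarrow> cell \<Rightarrow> cell \<Rightarrow> nat) \<Rightarrow> cell list \<Rightarrow> nat" where
  "row_weight F (x # y # z # r) = F x y z * row_weight F (y # z # r)"
| "row_weight F _ = 1"

lemma row_weight_pos_iff:
  "row_weight F b > 0 \<longleftrightarrow>
     (\<forall>i. Suc (Suc i) < length b \<longrightarrow> F (b ! i) (b ! Suc i) (b ! Suc (Suc i)) > 0)"
proof (induction F b rule: row_weight.induct)
  case (1 F x y z r)
  then show ?case by (simp add: All_less_Suc2)
qed auto

lemma row_weight_le_power:
  assumes "\<And>x y z. F x y z \<le> M" "M \<ge> 1"
  shows "row_weight F b \<le> M ^ length b"
  using assms
proof (induction F b rule: row_weight.induct)
  case (1 F x y z r)
  then have "F x y z * row_weight F (y # z # r) \<le> M * M ^ length (y # z # r)"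
    by (intro mult_le_mono) auto
  then show ?case by simp
qed (simp_all add: Suc_le_eq)

lemma row_weight_Cons_le:
  assumes "row_weight F (x # b) > 0"
  shows "row_weight F b \<le> row_weight F (x # b)"
  using assms by (cases "(F, x # b)" rule: row_weight.cases) auto

definition fill_sum :: "(cell \<Rightarrow> cell \<Rightarrow> cell \<Rightarrow> nat) \<Rightarrow> bool \<Rightarrow> cell \<Rightarrow> cell \<Rightarrow> cell list \<Rightarrow> nat" where
  "fill_sum F e a a' bs = (\<Sum>xs\<in>fills e a' bs. row_weight F (a # a' # xs))"

lemma fill_sum_Cons:
  "fill_sum F e a a' (b # b' # bs) =
     (\<Sum>x | allowed a' b b' x. F a a' x * fill_sum F e a' x (b' # bs))"
proof -
  have "fill_sum F e a a' (b # b' # bs) =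
      (\<Sum>x | allowed a' b b' x. \<Sum>xs\<in>(#) x ` fills e x (b' # bs). row_weight F (a # a' # xs))"
    unfolding fill_sum_def fills.simps by (rule sum.UNION_disjoint) auto
  also have "\<dots> = (\<Sum>x | allowed a' b b' x. F a a' x * fill_sum F e a' x (b' # bs))"
    by (simp add: sum.reindex fill_sum_def sum_distrib_left)
  finally show ?thesis .
qed

text \<open>Within a row the sum over new rows is done entry by entry. The front between new and old row
  has a kink, and \<open>G a a' b0 b1 b2\<close> is a weight for the five entries next to it: the last two
  new ones and the first three old ones. Moving the kink by one entry turns \<open>G\<close> into
  \<open>kink_sum F G\<close>, where \<open>b3\<close> is the old entry that comes into view.\<close>

definition kink_sum ::
    "(cell \<Rightarrow> cell \<Rightarrow> cell \<Rightarrow> nat) \<Rightarrow> (cell \<Rightarrow> cell \<Rightarrow> cell \<Rightarrow> cell \<Rightarrow> cell \<Rightarrow> nat) \<Rightarrow>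
     cell \<Rightarrow> cell \<Rightarrow> cell \<Rightarrow> cell \<Rightarrow> cell \<Rightarrow> cell \<Rightarrow> nat" where
  "kink_sum F G a a' b0 b1 b2 b3 = (\<Sum>x | allowed a' b0 b1 x. F a a' x * G a' x b1 b2 b3)"

text \<open>Row weights of new entries are earned and those of old entries are spent while the kink moves
  along the row. Hence a local inequality for one step, with factor \<open>p / q\<close>, multiplies up to the
  whole row.\<close>

lemma fill_sum_le:
  assumes cert: "\<And>a a' b0 b1 b2 b3. F b0 b1 b2 > 0 \<Longrightarrow> F b1 b2 b3 > 0 \<Longrightarrow>
      q * kink_sum F G a a' b0 b1 b2 b3 \<le> p * (F b1 b2 b3 * G a a' b0 b1 b2)"
    and base: "\<And>a a' b0 b1 b2. F b0 b1 b2 > 0 \<Longrightarrow>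
      fill_sum F e a a' [b0, b1, b2] \<le> K * G a a' b0 b1 b2"
    and pos: "row_weight F (b0 # b1 # b2 # r) > 0"
  shows "q ^ length r * fill_sum F e a a' (b0 # b1 # b2 # r)
           \<le> p ^ length r * (K * G a a' b0 b1 b2 * row_weight F (b1 # b2 # r))"
  using pos
proof (induction r arbitrary: a a' b0 b1 b2)
  case Nil
  then show ?case using base by simp
next
  case (Cons b3 r)
  let ?n = "length r" and ?W = "row_weight F (b2 # b3 # r)"
  have "q ^ length (b3 # r) * fill_sum F e a a' (b0 # b1 # b2 # b3 # r) =
      q * (\<Sum>x | allowed a' b0 b1 x. F a a' x * (q ^ ?n * fill_sum F e a' x (b1 # b2 # b3 # r)))"
    unfolding fill_sum_Cons[of _ _ _ _ b0] by (simp add: sum_distrib_left mult_ac)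
  also have "\<dots> \<le> q * (\<Sum>x | allowed a' b0 b1 x. F a a' x * (p ^ ?n * (K * G a' x b1 b2 b3 * ?W)))"
    using Cons.prems by (intro mult_le_mono sum_mono Cons.IH) auto
  also have "\<dots> = p ^ ?n * K * ?W * (q * kink_sum F G a a' b0 b1 b2 b3)"
    by (simp add: kink_sum_def sum_distrib_left mult_ac)
  also have "\<dots> \<le> p ^ ?n * K * ?W * (p * (F b1 b2 b3 * G a a' b0 b1 b2))"
    using Cons.prems by (intro mult_le_mono cert) auto
  finally show ?case by (simp add: mult_ac)
qed

lemma fill_sum_ge:
  assumes cert: "\<And>a a' b0 b1 b2 b3.
      p * (F b1 b2 b3 * G a a' b0 b1 b2) \<le> q * kink_sum F G a a' b0 b1 b2 b3"
    and base: "\<And>a a' b0 b1 b2. G a a' b0 b1 b2 \<le> K * fill_sum F e a a' [b0, b1, b2]"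
  shows "p ^ length r * (G a a' b0 b1 b2 * row_weight F (b1 # b2 # r))
           \<le> q ^ length r * (K * fill_sum F e a a' (b0 # b1 # b2 # r))"
proof (induction r arbitrary: a a' b0 b1 b2)
  case Nil
  then show ?case using base by simp
next
  case (Cons b3 r)
  let ?n = "length r" and ?W = "row_weight F (b2 # b3 # r)"
  have "p ^ length (b3 # r) * (G a a' b0 b1 b2 * row_weight F (b1 # b2 # b3 # r)) =
      p ^ ?n * ?W * (p * (F b1 b2 b3 * G a a' b0 b1 b2))"
    by (simp add: mult_ac)
  also have "\<dots> \<le> p ^ ?n * ?W * (q * kink_sum F G a a' b0 b1 b2 b3)"
    by (intro mult_le_mono cert) auto
  also have "\<dots> = q * (\<Sum>x | allowed a' b0 b1 x. F a a' x * (p ^ ?n * (G a' x b1 b2 b3 * ?W)))"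
    by (simp add: kink_sum_def sum_distrib_left mult_ac)
  also have "\<dots> \<le> q * (\<Sum>x | allowed a' b0 b1 x.
      F a a' x * (q ^ ?n * (K * fill_sum F e a' x (b1 # b2 # b3 # r))))"
    by (intro mult_le_mono sum_mono Cons.IH) auto
  also have "\<dots> = q ^ length (b3 # r) * (K * fill_sum F e a a' (b0 # b1 # b2 # b3 # r))"
    unfolding fill_sum_Cons[of _ _ _ _ b0] by (simp add: sum_distrib_left mult_ac)
  finally show ?case .
qed

lemma bounded_on_cells:
  fixes f :: "cell \<Rightarrow> cell \<Rightarrow> cell \<Rightarrow> cell \<Rightarrow> cell \<Rightarrow> nat"
  obtains K where "\<And>a a' b0 b1 b2. f a a' b0 b1 b2 \<le> K"
proof -
  let ?f = "\<lambda>(a, a', b0, b1, b2). f a a' b0 b1 b2"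
  have "?f (a, a', b0, b1, b2) \<le> Max (range ?f)" for a a' b0 b1 b2 :: cell
    by (intro Max_ge rangeI) simp
  then show ?thesis using that[of "Max (range ?f)"] by simp
qed

section \<open>Upper bound for one row\<close>

definition rows :: "(cell \<Rightarrow> cell \<Rightarrow> cell \<Rightarrow> nat) \<Rightarrow> nat \<Rightarrow> cell list set" where
  "rows F m = {b. length b = m \<and> row_weight F b > 0}"

text \<open>For the upper bound the first two entries of the new row are left free: their parents may lie
  outside the row, and freedom in boundedly many entries costs a constant factor per row.\<close>

definition upper_next :: "(cell \<Rightarrow> cell \<Rightarrow> cell \<Rightarrow> nat) \<Rightarrow> cell list \<Rightarrow> cell list set" where
  "upper_next F b = {a \<in> rows F (length b). \<exists>a0 a1 xs. a = a0 # a1 # xs \<and> xs \<in> fills False a1 (tl b)}"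

lemma finite_rows [simp]: "finite (rows F m)"
  by (rule finite_subset[OF _ finite_lists_length_eq[of UNIV m]]) (auto simp: rows_def)

lemma card_rows_le: "card (rows F m) \<le> 3 ^ m"
proof -
  have "card (rows F m) \<le> card {b :: cell list. set b \<subseteq> UNIV \<and> length b = m}"
    by (rule card_mono[OF finite_lists_length_eq]) (auto simp: rows_def)
  also have "\<dots> = 3 ^ m"
    using card_lists_length_eq[of "UNIV :: cell set" m] by (simp add: UNIV_cell numeral_3_eq_3)
  finally show ?thesis .
qed

lemma finite_upper_next [simp]: "finite (upper_next F b)"
  by (simp add: upper_next_def)

lemma sum_upper_next_le:
  "(\<Sum>a\<in>upper_next F b. row_weight F a) \<le> (\<Sum>a0\<in>UNIV. \<Sum>a1\<in>UNIV. fill_sum F False a0 a1 (tl b))"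
proof -
  let ?T = "SIGMA a0 : (UNIV :: cell set). SIGMA a1 : UNIV. fills False a1 (tl b)"
  let ?f = "\<lambda>(a0, a1, xs). a0 # a1 # xs :: cell list"
  have fin: "finite ?T" by auto
  have "(\<Sum>a\<in>upper_next F b. row_weight F a) \<le> (\<Sum>a\<in>?f ` ?T. row_weight F a)"
    using fin by (intro sum_mono2) (force simp: upper_next_def)+
  also have "\<dots> = (\<Sum>t\<in>?T. row_weight F (?f t))"
    by (subst sum.reindex) (auto simp: inj_on_def)
  also have "\<dots> = (\<Sum>a0\<in>UNIV. \<Sum>a1\<in>UNIV. fill_sum F False a0 a1 (tl b))"
    by (simp add: sum.Sigma fill_sum_def split_beta)
  finally show ?thesis .
qed

text \<open>The kink weights are bounded and at least 1 where they matter, so they only enter the constant.\<close>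

lemma card_upper_paths_le:
  assumes cert: "\<And>a a' b0 b1 b2 b3. F b0 b1 b2 > 0 \<Longrightarrow> F b1 b2 b3 > 0 \<Longrightarrow>
      q * kink_sum F G a a' b0 b1 b2 b3 \<le> p * (F b1 b2 b3 * G a a' b0 b1 b2)"
    and G: "\<And>a a' b0 b1 b2. F b0 b1 b2 > 0 \<Longrightarrow> G a a' b0 b1 b2 \<ge> 1"
    and pq: "0 < q" "q \<le> p"
  obtains c :: real where "c > 0"
    "\<And>m n b. m \<ge> 4 \<Longrightarrow> b \<in> rows F m \<Longrightarrow>
       real (card (paths (upper_next F) n b)) \<le> (c * (real p / real q) ^ m) ^ n * real (row_weight F b)"
proof -
  obtain K where K: "\<And>a a' b0 b1 b2. fill_sum F False a a' [b0, b1, b2] \<le> K"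
    using bounded_on_cells[of "\<lambda>a a' b0 b1 b2. fill_sum F False a a' [b0, b1, b2]"] by blast
  obtain L where L: "\<And>a a' b0 b1 b2. G a a' b0 b1 b2 \<le> L"
    using bounded_on_cells[of G] by blast
  define x where "x = real p / real q"
  have x: "x \<ge> 1" using pq by (simp add: x_def)
  \<comment> \<open>9 choices of the two free entries; the summand 1 keeps \<open>c\<close> positive\<close>
  define c where "c = real (9 * K * L + 1)"
  have "0 < 9 * K * L + 1" by simp
  then have c: "c > 0" unfolding c_def by (simp only: of_nat_0_less_iff)
  have base: "fill_sum F False a a' [b0, b1, b2] \<le> K * G a a' b0 b1 b2" if "F b0 b1 b2 > 0" for a a' b0 b1 b2
    using K[of a a' b0 b1 b2] G[OF that, of a a'] by (metis le_trans mult_le_mono2 mult.right_neutral)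
  have step: "(\<Sum>a\<in>upper_next F b. real (row_weight F a)) \<le> c * x ^ m * real (row_weight F b)"
    if m: "m \<ge> 4" and b: "b \<in> rows F m" for m b
  proof -
    obtain b0 b1 b2 b3 r where eq: "b = b0 # b1 # b2 # b3 # r"
    proof -
      have "length b \<ge> 4" using m b by (simp add: rows_def)
      then show thesis using that by (auto simp: Suc_le_length_iff numeral_eq_Suc)
    qed
    have pos: "row_weight F b > 0" using b by (simp add: rows_def)
    have pos': "row_weight F (tl b) > 0"
      using pos by (simp add: eq)
    have W: "row_weight F (b2 # b3 # r) \<le> row_weight F b"
      using row_weight_Cons_le[of F b0 "tl b"] row_weight_Cons_le[of F b1 "b2 # b3 # r"] pos pos'
      by (simp add: eq del: row_weight.simps)
    have "real (fill_sum F False a a' (tl b)) \<le> real (K * L) * x ^ m * real (row_weight F b)" for a a'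
    proof -
      let ?n = "length r"
      have "q ^ ?n * fill_sum F False a a' (tl b)
          \<le> p ^ ?n * (K * G a a' b1 b2 b3 * row_weight F (b2 # b3 # r))"
        using fill_sum_le[of F q G p False K b1 b2 b3 r a a', OF cert base] pos' by (simp add: eq)
      also have "\<dots> \<le> p ^ ?n * (K * L * row_weight F b)"
        by (intro mult_le_mono L W) auto
      finally have "real (q ^ ?n * fill_sum F False a a' (tl b)) \<le> real (p ^ ?n * (K * L * row_weight F b))"
        by (simp only: of_nat_le_iff)
      then have "real (fill_sum F False a a' (tl b)) \<le> x ^ ?n * (real (K * L) * real (row_weight F b))"
        using pq by (simp add: x_def power_divide field_simps)
      also have "\<dots> \<le> x ^ m * (real (K * L) * real (row_weight F b))"
        using x b by (intro mult_right_mono power_increasing) (auto simp: rows_def eq)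
      finally show ?thesis by (simp add: mult_ac)
    qed
    then have "(\<Sum>a0\<in>UNIV. \<Sum>a1\<in>UNIV. real (fill_sum F False a0 a1 (tl b))) \<le>
        (\<Sum>a0\<in>(UNIV :: cell set). \<Sum>a1\<in>(UNIV :: cell set). real (K * L) * x ^ m * real (row_weight F b))"
      by (intro sum_mono)
    also have "\<dots> = real (9 * K * L) * (x ^ m * real (row_weight F b))"
      by (simp add: UNIV_cell)
    also have "\<dots> \<le> c * (x ^ m * real (row_weight F b))"
      using x by (intro mult_right_mono) (auto simp: c_def)
    finally have "(\<Sum>a0\<in>UNIV. \<Sum>a1\<in>UNIV. real (fill_sum F False a0 a1 (tl b)))
      \<le> c * (x ^ m * real (row_weight F b))" .
    moreover have "real (\<Sum>a\<in>upper_next F b. row_weight F a) \<le>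
        real (\<Sum>a0\<in>UNIV. \<Sum>a1\<in>UNIV. fill_sum F False a0 a1 (tl b))"
      using sum_upper_next_le[of F b] by (simp only: of_nat_le_iff)
    ultimately show ?thesis by (simp add: mult.assoc)
  qed
  have "real (card (paths (upper_next F) n b)) \<le> (c * x ^ m) ^ n * real (row_weight F b)"
    if "m \<ge> 4" "b \<in> rows F m" for m n b
  proof (rule card_paths_le[where X = "rows F m"])
    show "upper_next F b \<subseteq> rows F m" if "b \<in> rows F m" for b
      using that by (auto simp: upper_next_def rows_def)
    show "1 \<le> real (row_weight F b)" if "b \<in> rows F m" for b
      using that by (simp add: rows_def Suc_le_eq)
  qed (use that step c x in auto)
  then show ?thesis using that[of c] c unfolding x_def by blast
qed

section \<open>Lower bound for one row\<close>

text \<open>For the lower bound a row is preceded by virtual covered entries, which neither cover nor need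
  cover. They stand for vacant sites to the left of the row. New rows of
  weight 0 are left out, as they may contain a bare site between two occupied ones, which
  nothing can cover.\<close>

definition lower_next :: "(cell \<Rightarrow> cell \<Rightarrow> cell \<Rightarrow> nat) \<Rightarrow> cell list \<Rightarrow> cell list set" where
  "lower_next F b = {a \<in> fills True Cov (Cov # b). row_weight F (Cov # Cov # a) > 0}"

lemma finite_lower_next [simp]: "finite (lower_next F b)"
  by (simp add: lower_next_def)

lemma length_lower_next: "a \<in> lower_next F b \<Longrightarrow> length a = length b"
  by (simp add: lower_next_def fills_iff)

lemma sum_lower_next:
  "(\<Sum>a\<in>lower_next F b. row_weight F (Cov # Cov # a)) = fill_sum F True Cov Cov (Cov # b)"
  unfolding fill_sum_def lower_next_def by (rule sum.mono_neutral_left) auto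

text \<open>Kinks of weight 0 are those that may be forced into a dead end by the entries still out of view.
  The hypotheses \<open>base\<close> and \<open>start\<close> say that every other kink can be completed at the end of
  the row and that no row begins with a dead end.\<close>

lemma card_lower_paths_ge:
  assumes cert: "\<And>a a' b0 b1 b2 b3.
      p * (F b1 b2 b3 * G a a' b0 b1 b2) \<le> q * kink_sum F G a a' b0 b1 b2 b3"
    and base: "\<And>a a' b0 b1 b2. G a a' b0 b1 b2 > 0 \<Longrightarrow> fill_sum F True a a' [b0, b1, b2] > 0"
    and start: "\<And>b0 b1. F Cov b0 b1 > 0 \<Longrightarrow> G Cov Cov Cov b0 b1 > 0"
    and pq: "0 < p" "0 < q" and M: "\<And>x y z. F x y z \<le> M"
  obtains c :: real where "c > 0"
    "\<And>m b. m \<ge> 2 \<Longrightarrow> length b = m \<Longrightarrow> row_weight F (Cov # Cov # b) > 0 \<Longrightarrow> lower_next F b \<noteq> {}"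
    "\<And>m n b. m \<ge> 2 \<Longrightarrow> length b = m \<Longrightarrow> row_weight F (Cov # Cov # b) > 0 \<Longrightarrow>
       (c * (real p / real q) ^ m) ^ n \<le> real (card (paths (lower_next F) n b)) * real (M + 1) ^ (m + 2)"
proof -
  obtain K where K: "\<And>a a' b0 b1 b2. G a a' b0 b1 b2 \<le> K"
    using bounded_on_cells[of G] by blast
  define x where "x = real p / real q"
  have x: "x > 0" using pq by (simp add: x_def)
  define N where "N = (M + 1) ^ 2 * (K + 1)"
  have N: "N > 0" by (simp add: N_def)
  \<comment> \<open>\<open>x ^ 2\<close> because the kink makes only \<open>m - 2\<close> steps in a row of length \<open>m\<close>\<close>
  define c where "c = 1 / (x ^ 2 * real N)"
  have c: "c > 0" using x N by (simp add: c_def)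
  have base': "G a a' b0 b1 b2 \<le> (K + 1) * fill_sum F True a a' [b0, b1, b2]" for a a' b0 b1 b2
  proof (cases "G a a' b0 b1 b2 > 0")
    case True
    then have "1 \<le> fill_sum F True a a' [b0, b1, b2]" using base by (simp add: Suc_le_eq)
    then show ?thesis using K[of a a' b0 b1 b2] by (metis le_trans mult_le_mono2 mult.right_neutral trans_le_add1)
  qed simp
  define V where "V b = real (row_weight F (Cov # Cov # b))" for b
  have step: "c * x ^ m * V b \<le> (\<Sum>a\<in>lower_next F b. V a)"
    if m: "m \<ge> 2" and b: "length b = m" and pos: "row_weight F (Cov # Cov # b) > 0" for m b
  proof -
    obtain b0 b1 r where eq: "b = b0 # b1 # r"
      using m b by (metis Suc_le_length_iff numeral_2_eq_2)
    let ?n = "length r" and ?W = "row_weight F (b0 # b1 # r)"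
    let ?S = "fill_sum F True Cov Cov (Cov # b)"
    have "1 \<le> G Cov Cov Cov b0 b1" using start[of b0 b1] pos by (simp add: eq Suc_le_eq)
    then have "p ^ ?n * (1 * ?W) \<le> p ^ ?n * (G Cov Cov Cov b0 b1 * ?W)"
      by (intro mult_le_mono) auto
    also have "\<dots> \<le> q ^ ?n * ((K + 1) * ?S)"
      using fill_sum_ge[of p F G q "K + 1" True r Cov Cov Cov b0 b1, OF cert base'] by (simp add: eq)
    finally have *: "p ^ ?n * ?W \<le> q ^ ?n * ((K + 1) * ?S)" by simp
    have "row_weight F (Cov # Cov # b) = F Cov Cov b0 * F Cov b0 b1 * ?W" by (simp add: eq)
    also have "\<dots> \<le> (M + 1) * (M + 1) * ?W"
      by (intro mult_le_mono le_trans[OF M]) auto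
    finally have "p ^ ?n * row_weight F (Cov # Cov # b) \<le> p ^ ?n * ((M + 1) ^ 2 * ?W)"
      by (intro mult_le_mono) (auto simp: power2_eq_square)
    also have "\<dots> \<le> (M + 1) ^ 2 * (q ^ ?n * ((K + 1) * ?S))"
      using mult_le_mono2[OF *, of "(M + 1) ^ 2"] by (simp only: mult_ac)
    also have "\<dots> = q ^ ?n * (N * ?S)" by (simp only: N_def mult_ac)
    finally have "real (p ^ ?n * row_weight F (Cov # Cov # b)) \<le> real (q ^ ?n * (N * ?S))"
      by (simp only: of_nat_le_iff)
    then have "real p ^ ?n * V b \<le> real q ^ ?n * (real N * real ?S)"
      unfolding V_def by (simp only: of_nat_mult of_nat_power)
    then have "x ^ ?n * V b \<le> real N * real ?S"
      using pq by (simp add: x_def power_divide field_simps)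
    moreover have "c * x ^ m = x ^ ?n / real N"
      using x b by (auto simp add: c_def eq power2_eq_square field_simps)
    ultimately have "c * x ^ m * V b \<le> real ?S"
      using N by (simp add: divide_le_eq mult.commute)
    then show ?thesis
      by (simp add: V_def flip: sum_lower_next)
  qed
  have ne: "lower_next F b \<noteq> {}"
    if m: "m \<ge> 2" and b: "length b = m" and pos: "row_weight F (Cov # Cov # b) > 0" for m b
  proof
    assume "lower_next F b = {}"
    then have "c * x ^ m * V b \<le> 0" using step[OF that] by simp
    moreover have "0 < c * x ^ m * V b" using c x pos by (simp add: V_def)
    ultimately show False by simp
  qed
  have "(c * x ^ m) ^ n \<le> real (card (paths (lower_next F) n b)) * real (M + 1) ^ (m + 2)"
    if m: "m \<ge> 2" and b: "length b = m" and pos: "row_weight F (Cov # Cov # b) > 0" for m n b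
  proof -
    define X where "X = {b. length b = m \<and> row_weight F (Cov # Cov # b) > 0}"
    have high: "V b \<le> real (M + 1) ^ (m + 2)" if "b \<in> X" for b
    proof -
      have "row_weight F (Cov # Cov # b) \<le> (M + 1) ^ length (Cov # Cov # b)"
        by (rule row_weight_le_power) (use M in \<open>auto intro: le_SucI\<close>)
      then have "V b \<le> real ((M + 1) ^ length (Cov # Cov # b))"
        unfolding V_def by (simp only: of_nat_le_iff)
      moreover have "length (Cov # Cov # b) = m + 2" using that by (simp add: X_def)
      ultimately show ?thesis by (simp only: of_nat_power)
    qed
    have "(c * x ^ m) ^ n * 1 \<le> (c * x ^ m) ^ n * V b"
      using c x pos by (intro mult_left_mono) (auto simp: V_def Suc_le_eq)
    also have "\<dots> \<le> real (card (paths (lower_next F) n b)) * real (M + 1) ^ (m + 2)"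
    proof (rule card_paths_ge[where X = X])
      show "lower_next F b \<subseteq> X" if "b \<in> X" for b
        using that length_lower_next[of _ F b] by (auto simp: X_def) (simp add: lower_next_def)
    qed (use c x step high that in \<open>auto simp: X_def\<close>)
    finally show ?thesis by simp
  qed
  then show ?thesis using that[of c] c ne unfolding x_def by blast
qed

section \<open>Reading a configuration along diagonals\<close>

definition status :: "config \<Rightarrow> site \<Rightarrow> cell" where
  "status \<eta> = (\<lambda>(x, y). if \<eta> (x, y) then Occ else if \<eta> (x - 1, y) \<or> \<eta> (x, y - 1) then Cov else Bare)"

lemma status_eq_Occ [simp]: "status \<eta> i = Occ \<longleftrightarrow> \<eta> i"
  by (cases i) (simp add: status_def)

text \<open>Windows that occur in a maximal independent set. A bare site between two occupied ones has only
  children with an occupied parent, so nothing can cover it. A covered site shares its occupied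
  parent with one of its neighbours in the row, so that neighbour is covered as well.\<close>

definition valid :: "cell \<Rightarrow> cell \<Rightarrow> cell \<Rightarrow> bool" where
  "valid x y z \<longleftrightarrow> \<not> (x = Occ \<and> y = Bare \<and> z = Occ) \<and> (y = Cov \<longrightarrow> x = Cov \<or> z = Cov)"

lemma status_eq_Cov:
  "status \<eta> (x, y) = Cov \<longleftrightarrow> \<not> \<eta> (x, y) \<and> (\<eta> (x - 1, y) \<or> \<eta> (x, y - 1))"
  by (simp add: status_def)

lemma status_eq_Bare:
  "status \<eta> (x, y) = Bare \<longleftrightarrow> \<not> \<eta> (x, y) \<and> \<not> \<eta> (x - 1, y) \<and> \<not> \<eta> (x, y - 1)"
  by (simp add: status_def)

lemma status_allowed:
  assumes "maximal_independent \<eta>"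
  shows "allowed (status \<eta> (x + 1, y)) (status \<eta> (x, y)) (status \<eta> (x - 1, y + 1)) (status \<eta> (x, y + 1))"
proof -
  have r: "recovery_rule \<eta> i" for i using assms unfolding maximal_independent_def by blast
  have "status \<eta> (x, y + 1) = Cov \<longleftrightarrow> \<eta> (x, y) \<or> \<eta> (x - 1, y + 1)"
    using r[of "(x, y + 1)"] unfolding recovery_rule_iff status_eq_Cov by simp blast
  moreover have "\<eta> (x, y + 1)" if "status \<eta> (x, y) = Bare" "\<not> \<eta> (x + 1, y)"
    using that r[of "(x, y)"] unfolding recovery_rule_iff status_eq_Bare by blast
  ultimately show ?thesis unfolding allowed_def status_eq_Occ by blast
qed

lemma status_valid:
  assumes "maximal_independent \<eta>"
  shows "valid (status \<eta> (x + 1, y - 1)) (status \<eta> (x, y)) (status \<eta> (x - 1, y + 1))"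
proof -
  have r: "recovery_rule \<eta> i" for i using assms unfolding maximal_independent_def by blast
  have indep: "\<not> \<eta> (x, y + 1) \<and> \<not> \<eta> (x + 1, y)" if "\<eta> (x, y)" for x y
    using that r[of "(x, y)"] unfolding recovery_rule_iff by blast
  have "\<eta> (x, y + 1) \<or> \<eta> (x + 1, y)" if "status \<eta> (x, y) = Bare"
    using that r[of "(x, y)"] unfolding recovery_rule_iff status_eq_Bare by blast
  then have "\<not> (\<eta> (x + 1, y - 1) \<and> status \<eta> (x, y) = Bare \<and> \<eta> (x - 1, y + 1))"
    using indep[of "x + 1" "y - 1"] indep[of "x - 1" "y + 1"] by auto
  moreover have "status \<eta> (x + 1, y - 1) = Cov \<or> status \<eta> (x - 1, y + 1) = Cov" if "status \<eta> (x, y) = Cov"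
    using that indep[of "x - 1" y] indep[of x "y - 1"] unfolding status_eq_Cov by simp blast
  ultimately show ?thesis unfolding valid_def status_eq_Occ by blast
qed

definition diagonal :: "config \<Rightarrow> nat \<Rightarrow> nat \<Rightarrow> cell list" where
  "diagonal \<eta> m d = map (\<lambda>j. status \<eta> (slant d j)) [0..<m]"

lemma length_diagonal [simp]: "length (diagonal \<eta> m d) = m"
  by (simp add: diagonal_def)

lemma diagonal_in_rows:
  assumes "maximal_independent \<eta>" and F: "\<And>x y z. F x y z > 0 \<longleftrightarrow> valid x y z"
  shows "diagonal \<eta> m d \<in> rows F m"
proof -
  have "valid (status \<eta> (slant d i)) (status \<eta> (slant d (Suc i))) (status \<eta> (slant d (Suc (Suc i))))" for i
    using status_valid[OF assms(1), of "int d - int (Suc i)" "int (Suc i)"]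
    by (simp add: slant_def algebra_simps)
  then show ?thesis
    by (simp add: rows_def row_weight_pos_iff F diagonal_def)
qed

lemma diagonal_Suc_in_upper_next:
  assumes "maximal_independent \<eta>" and F: "\<And>x y z. F x y z > 0 \<longleftrightarrow> valid x y z" and m: "m \<ge> 4"
  shows "diagonal \<eta> m (Suc d) \<in> upper_next F (diagonal \<eta> m d)"
proof -
  let ?a = "\<lambda>j. status \<eta> (slant (Suc d) j)" and ?b = "\<lambda>j. status \<eta> (slant d j)"
  define xs where "xs = map ?a [2..<m]"
  have eq: "diagonal \<eta> m (Suc d) = ?a 0 # ?a 1 # xs"
    using m by (simp add: diagonal_def xs_def upt_rec numeral_2_eq_2)
  have tl: "tl (diagonal \<eta> m d) = map ?b [1..<m]"
    by (simp add: diagonal_def map_tl[symmetric])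
  have al: "allowed (?a j) (?b j) (?b (Suc j)) (?a (Suc j))" for j
    using status_allowed[OF assms(1), of "int d - int j" "int j"]
    by (simp add: slant_def algebra_simps)
  have "(?a 1 # xs) ! i = ?a (Suc i)" if "i < m - 1" for i
    using that by (cases i) (auto simp: xs_def numeral_2_eq_2)
  then have "xs \<in> fills False (?a 1) (map ?b [1..<m])"
    using m al by (subst fills_iff) (auto simp: xs_def numeral_2_eq_2)
  then have "\<exists>a0 a1 ys. diagonal \<eta> m (Suc d) = a0 # a1 # ys \<and> ys \<in> fills False a1 (tl (diagonal \<eta> m d))"
    unfolding eq tl by blast
  then show ?thesis
    using diagonal_in_rows[OF assms(1) F] by (simp add: upper_next_def)
qed

lemma diagonals_in_paths:
  assumes "maximal_independent \<eta>" and F: "\<And>x y z. F x y z > 0 \<longleftrightarrow> valid x y z" and m: "m \<ge> 4"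
  shows "map (diagonal \<eta> m) [Suc d..<Suc (d + n)] \<in> paths (upper_next F) n (diagonal \<eta> m d)"
proof (induction n arbitrary: d)
  case (Suc n)
  have eq: "map (diagonal \<eta> m) [Suc d..<Suc (d + Suc n)] =
      diagonal \<eta> m (Suc d) # map (diagonal \<eta> m) [Suc (Suc d)..<Suc (Suc d + n)]"
    by (simp add: upt_rec[of "Suc d"] del: upt_Suc)
  show ?case
    unfolding eq paths.simps
    by (rule UN_I, rule diagonal_Suc_in_upper_next[OF assms], rule imageI, rule Suc)
qed simp

text \<open>The rows of states of a maximal independent set form a path, and the path determines the
  pattern.\<close>

lemma card_patterns_le_paths:
  assumes F: "\<And>x y z. F x y z > 0 \<longleftrightarrow> valid x y z" and m: "m \<ge> 4"
  shows "card (patterns (parallelogram m (Suc n))) \<le> card (SIGMA b : rows F m. paths (upper_next F) n b)"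
proof -
  define dec where "dec = (\<lambda>(b :: cell list, p). \<lambda>i \<in> parallelogram m (Suc n).
      (b # p) ! nat (fst i + snd i) ! nat (snd i) = Occ)"
  let ?S = "SIGMA b : rows F m. paths (upper_next F) n b"
  have "patterns (parallelogram m (Suc n)) \<subseteq> dec ` ?S"
  proof
    fix q assume "q \<in> patterns (parallelogram m (Suc n))"
    then obtain \<eta> where \<eta>: "maximal_independent \<eta>" "q = restrict \<eta> (parallelogram m (Suc n))"
      by (auto simp: patterns_def)
    let ?p = "map (diagonal \<eta> m) [1..<Suc n]"
    have "(diagonal \<eta> m 0 # ?p) ! d = diagonal \<eta> m d" if "d < Suc n" for d
      using that by (cases d) (auto simp del: upt_Suc)
    then have "q = dec (diagonal \<eta> m 0, ?p)"
      unfolding \<eta>(2) dec_def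
      by (auto simp: fun_eq_iff restrict_def parallelogram_def slant_def diagonal_def simp del: upt_Suc)
    moreover have "(diagonal \<eta> m 0, ?p) \<in> ?S"
      using diagonal_in_rows[OF \<eta>(1) F] diagonals_in_paths[OF \<eta>(1) F m, of 0 n] by simp
    ultimately show "q \<in> dec ` ?S" by blast
  qed
  moreover have "finite ?S" by (intro finite_SigmaI finite_rows finite_paths finite_upper_next)
  ultimately show ?thesis by (rule surj_card_le[rotated])
qed

lemma bit_rate_le_certificate:
  assumes F: "\<And>x y z. F x y z > 0 \<longleftrightarrow> valid x y z" and M: "\<And>x y z. F x y z \<le> M"
    and cert: "\<And>a a' b0 b1 b2 b3. F b0 b1 b2 > 0 \<Longrightarrow> F b1 b2 b3 > 0 \<Longrightarrow>
      q * kink_sum F G a a' b0 b1 b2 b3 \<le> p * (F b1 b2 b3 * G a a' b0 b1 b2)"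
    and G: "\<And>a a' b0 b1 b2. F b0 b1 b2 > 0 \<Longrightarrow> G a a' b0 b1 b2 \<ge> 1"
    and pq: "0 < q" "q \<le> p"
  shows "bit_rate \<le> log 2 (real p / real q)"
proof -
  define x where "x = real p / real q"
  obtain c :: real where c: "c > 0" and le: "\<And>m n b. m \<ge> 4 \<Longrightarrow> b \<in> rows F m \<Longrightarrow>
       real (card (paths (upper_next F) n b)) \<le> (c * x ^ m) ^ n * real (row_weight F b)"
    using card_upper_paths_le[of F q G p, OF cert G pq] unfolding x_def by blast
  have x: "x > 0" using pq by (simp add: x_def)
  have "real (card (patterns (parallelogram m (Suc n)))) \<le> real (3 * (M + 1)) ^ m * (c * x ^ m) ^ n"
    if m: "m \<ge> 4" for m n
  proof -
    have "real (card (patterns (parallelogram m (Suc n)))) \<le>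
        real (card (SIGMA b : rows F m. paths (upper_next F) n b))"
      using card_patterns_le_paths[OF F m] by simp
    also have "\<dots> = (\<Sum>b\<in>rows F m. real (card (paths (upper_next F) n b)))"
      by (simp add: card_SigmaI finite_paths)
    also have "\<dots> \<le> (\<Sum>b\<in>rows F m. (c * x ^ m) ^ n * real (M + 1) ^ m)"
    proof (rule sum_mono)
      fix b assume b: "b \<in> rows F m"
      have "row_weight F b \<le> (M + 1) ^ length b"
        by (rule row_weight_le_power) (use M in \<open>auto intro: le_SucI\<close>)
      then have "real (row_weight F b) \<le> real ((M + 1) ^ m)"
        using b unfolding rows_def by (simp only: of_nat_le_iff mem_Collect_eq)
      then have "(c * x ^ m) ^ n * real (row_weight F b) \<le> (c * x ^ m) ^ n * real (M + 1) ^ m"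
        using c x by (intro mult_left_mono) (simp_all only: of_nat_power, simp)
      then show "real (card (paths (upper_next F) n b)) \<le> (c * x ^ m) ^ n * real (M + 1) ^ m"
        using le[OF m b, of n] by linarith
    qed
    also have "\<dots> = real (card (rows F m)) * ((c * x ^ m) ^ n * real (M + 1) ^ m)" by simp
    also have "\<dots> \<le> 3 ^ m * ((c * x ^ m) ^ n * real (M + 1) ^ m)"
    proof (rule mult_right_mono)
      have "real (card (rows F m)) \<le> real (3 ^ m)" using card_rows_le by (simp only: of_nat_le_iff)
      then show "real (card (rows F m)) \<le> 3 ^ m" by simp
    qed (use c x in simp)
    also have "\<dots> = real (3 * (M + 1)) ^ m * (c * x ^ m) ^ n"
      by (simp only: of_nat_mult of_nat_numeral power_mult_distrib mult_ac)
    finally show ?thesis .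
  qed
  then show ?thesis
    unfolding x_def[symmetric] using c x
    by (intro bit_rate_le_logI[where k = 4 and c = c and K = "real (3 * (M + 1))"]) simp_all
qed

section \<open>Building configurations from chains of rows\<close>

text \<open>An infinite sequence of rows permitted by the lower bound, beginning with a row of bare sites.\<close>

locale row_chain =
  fixes F :: "cell \<Rightarrow> cell \<Rightarrow> cell \<Rightarrow> nat" and m :: nat and r :: "nat \<Rightarrow> cell list"
  assumes m: "m \<ge> 1"
    and start: "r 0 = replicate m Bare"
    and step: "r (Suc d) \<in> lower_next F (r d)"
begin

lemma length_r [simp]: "length (r d) = m"
  by (induction d) (use start length_lower_next[OF step] in auto)

lemma allowed_r:
  assumes "j < m"
  shows "allowed (if j = 0 then Cov else r (Suc d) ! (j - 1)) (if j = 0 then Cov else r d ! (j - 1))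
           (r d ! j) (r (Suc d) ! j)"
proof -
  have "r (Suc d) \<in> fills True Cov (Cov # r d)" using step by (simp add: lower_next_def)
  then show ?thesis using assms by (auto simp: fills_iff nth_Cons')
qed

lemma last_r: "r d ! (m - 1) = Bare \<Longrightarrow> r (Suc d) ! (m - 1) \<noteq> Bare"
proof -
  have "r (Suc d) \<in> fills True Cov (Cov # r d)" using step by (simp add: lower_next_def)
  moreover have "r e \<noteq> []" for e using m length_r[of e] by force
  ultimately show "r d ! (m - 1) = Bare \<Longrightarrow> r (Suc d) ! (m - 1) \<noteq> Bare"
    using m by (auto simp: fills_iff last_conv_nth)
qed

lemma Cov_iff:
  assumes "j < m"
  shows "r (Suc d) ! j = Cov \<longleftrightarrow> r d ! j = Occ \<or> (j > 0 \<and> r d ! (j - 1) = Occ)"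
  using allowed_r[OF assms, of d] by (auto simp: allowed_def split: if_splits)

text \<open>The sites that the chain declares occupied, together with those beyond the right end (entry
  \<open>m\<close>) that cover a bare last entry whose inner child is covered.\<close>

definition occupied :: config where
  "occupied = (\<lambda>(x, y). 0 \<le> y \<and> 0 \<le> x + y \<and>
     (if y < int m then r (nat (x + y)) ! nat y = Occ
      else y = int m \<and> 1 \<le> x + y \<and> r (nat (x + y) - 1) ! (m - 1) = Bare \<and> r (nat (x + y)) ! (m - 1) = Cov))"

lemma occupied_slant: "j < m \<Longrightarrow> occupied (slant d j) \<longleftrightarrow> r d ! j = Occ"
  by (simp add: occupied_def slant_def)

lemma occupied_slant_m:
  "occupied (slant (Suc d) m) \<longleftrightarrow> r d ! (m - 1) = Bare \<and> r (Suc d) ! (m - 1) = Cov"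
proof -
  have "nat (1 + int d) = Suc d" by simp
  then show ?thesis by (simp add: occupied_def slant_def)
qed

lemma occupied_imp_slant:
  assumes "occupied (x, y)"
  obtains d j where "(x, y) = slant d j" "j \<le> m"
proof (rule that[of "nat (x + y)" "nat y"])
  show "(x, y) = slant (nat (x + y)) (nat y)" "nat y \<le> m"
    using assms by (auto simp: occupied_def slant_def split: if_splits)
qed

text \<open>Two sites beyond the right end cannot be adjacent: the lower one requires the last entry of its
  row to be covered, the upper one requires the same entry to be bare.\<close>

lemma occupied_child:
  assumes "occupied (slant d j)" "j \<le> m"
  shows "\<not> occupied (slant (Suc d) j)" and "\<not> occupied (slant (Suc d) (Suc j))"
proof -
  consider "Suc j < m" "r d ! j = Occ" | "Suc j = m" "r d ! j = Occ"
    | e where "j = m" "d = Suc e" "r d ! (m - 1) = Cov"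
  proof (cases "j = m")
    case True
    then have "d \<noteq> 0" using assms(1) by (auto simp: occupied_def slant_def)
    then obtain e where "d = Suc e" using not0_implies_Suc by blast
    then show ?thesis using that(3) assms(1) True occupied_slant_m by blast
  next
    case False
    then show ?thesis using that(1,2) assms occupied_slant[of j d] by linarith
  qed
  then have "\<not> occupied (slant (Suc d) j) \<and> \<not> occupied (slant (Suc d) (Suc j))"
  proof cases
    case 1
    then show ?thesis
      using Cov_iff[of j d] Cov_iff[of "Suc j" d] occupied_slant[of j "Suc d"] occupied_slant[of "Suc j" "Suc d"]
      by auto
  next
    case 2
    then show ?thesis
      using Cov_iff[of j d] occupied_slant[of j "Suc d"] occupied_slant_m[of d] by auto
  next
    case 3
    then show ?thesis
      using occupied_slant_m[of d] by (auto simp: occupied_def slant_def)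
  qed
  then show "\<not> occupied (slant (Suc d) j)" "\<not> occupied (slant (Suc d) (Suc j))" by blast+
qed

lemma occupied_independent:
  assumes "adj i k" "occupied i"
  shows "\<not> occupied k"
proof -
  have forward: "\<not> occupied (x + 1, y) \<and> \<not> occupied (x, y + 1)" if occ: "occupied (x, y)" for x y
  proof -
    obtain d j where dj: "(x, y) = slant d j" "j \<le> m" by (rule occupied_imp_slant[OF occ])
    then have "(x + 1, y) = slant (Suc d) j" "(x, y + 1) = slant (Suc d) (Suc j)"
      by (auto simp: slant_def)
    then show ?thesis using occupied_child[of d j] dj occ by simp
  qed
  obtain x y where i: "i = (x, y)" by fastforce
  then consider "k = (x + 1, y)" | "k = (x, y + 1)" | "k = (x - 1, y)" | "k = (x, y - 1)"
    using assms(1) by (auto simp: adj_iff)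
  then show ?thesis
    by cases (use assms(2) i forward[of x y] forward[of "x - 1" y] forward[of x "y - 1"] in auto)
qed

text \<open>A bare site is covered by a child, a covered one by a parent; the initial row has no covered
  site. Hence no maximal independent set above \<open>occupied\<close> adds a site within the rows.\<close>

lemma vacant_dominated:
  assumes j: "j < m" and vacant: "r d ! j \<noteq> Occ"
  shows "\<exists>k. adj (slant d j) k \<and> occupied k"
proof (cases "r d ! j")
  case Bare
  have child: "adj (slant d j) (slant (Suc d) j)" "adj (slant d j) (slant (Suc d) (Suc j))"
    by (simp_all add: slant_def adj_def)
  have "occupied (slant (Suc d) j) \<or> occupied (slant (Suc d) (Suc j))"
  proof (cases "Suc j < m")
    case True
    then show ?thesis
      using allowed_r[of "Suc j" d] Bare j
      by (auto simp: allowed_def occupied_slant)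
  next
    case False
    then have "j = m - 1" "Suc j = m" using j by auto
    then show ?thesis
      using last_r[of d] Bare occupied_slant_m[of d] occupied_slant[of j "Suc d"] j
      by (cases "r (Suc d) ! j") auto
  qed
  with child show ?thesis by blast
next
  case Cov
  then obtain e where d: "d = Suc e" using start j by (cases d) auto
  then have "r e ! j = Occ \<or> (j > 0 \<and> r e ! (j - 1) = Occ)" using Cov Cov_iff[OF j] by simp
  then show ?thesis
  proof
    assume "r e ! j = Occ"
    then have "occupied (slant e j)" using j occupied_slant by simp
    moreover have "adj (slant d j) (slant e j)" by (simp add: d slant_def adj_def)
    ultimately show ?thesis by blast
  next
    assume *: "j > 0 \<and> r e ! (j - 1) = Occ"
    then have "occupied (slant e (j - 1))" using j occupied_slant by simp
    moreover have "adj (slant d j) (slant e (j - 1))" using * by (simp add: d slant_def adj_def)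
    ultimately show ?thesis by blast
  qed
qed (use vacant in simp)

lemma realization:
  obtains \<eta> where "maximal_independent \<eta>" "\<And>d j. j < m \<Longrightarrow> \<eta> (slant d j) \<longleftrightarrow> r d ! j = Occ"
proof -
  obtain \<eta> where \<eta>: "maximal_independent \<eta>" and sub: "\<And>i. occupied i \<Longrightarrow> \<eta> i"
    using extend_to_maximal_independent[of occupied] occupied_independent by blast
  have "\<eta> (slant d j) \<longleftrightarrow> r d ! j = Occ" if j: "j < m" for d j
  proof
    assume "\<eta> (slant d j)"
    then have "\<not> \<eta> k" if "adj (slant d j) k" for k
      using \<eta> that unfolding maximal_independent_def recovery_rule_def by blast
    then show "r d ! j = Occ" using vacant_dominated[OF j, of d] sub by blast
  next
    assume "r d ! j = Occ"
    then show "\<eta> (slant d j)" using sub occupied_slant[OF j] by blast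
  qed
  with \<eta> show ?thesis using that by blast
qed

end

text \<open>Occupation determines the states recursively, starting from the fixed initial row.\<close>

lemma row_chains_agree:
  assumes r: "row_chain F m r" and s: "row_chain F m s"
    and occ: "\<And>d j. d \<le> n \<Longrightarrow> j < m \<Longrightarrow> r d ! j = Occ \<longleftrightarrow> s d ! j = Occ"
    and "d \<le> n"
  shows "r d = s d"
  using \<open>d \<le> n\<close>
proof (induction d)
  case 0
  then show ?case using row_chain.start[OF r] row_chain.start[OF s] by simp
next
  case (Suc d)
  show ?case
  proof (rule nth_equalityI)
    fix j assume "j < length (r (Suc d))"
    then have j: "j < m" using row_chain.length_r[OF r] by simp
    show "r (Suc d) ! j = s (Suc d) ! j"
      using occ[OF Suc.prems j] Suc row_chain.Cov_iff[OF r j, of d] row_chain.Cov_iff[OF s j, of d]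
      by (intro cell_eqI) auto
  qed (simp add: row_chain.length_r[OF r] row_chain.length_r[OF s])
qed

lemma paths_le_card_patterns:
  assumes m: "m \<ge> 1" and pos: "row_weight F (Cov # Cov # replicate m Bare) > 0"
    and ne: "\<And>b. length b = m \<Longrightarrow> row_weight F (Cov # Cov # b) > 0 \<Longrightarrow> lower_next F b \<noteq> {}"
  shows "card (paths (lower_next F) n (replicate m Bare)) \<le> card (patterns (parallelogram m (Suc n)))"
proof -
  let ?P = "parallelogram m (Suc n)" and ?S = "paths (lower_next F) n (replicate m Bare)"
  have ex: "\<exists>\<eta> r. maximal_independent \<eta> \<and> row_chain F m r \<and> p = map r [1..<Suc n] \<and>
      (\<forall>d. \<forall>j < m. \<eta> (slant d j) \<longleftrightarrow> r d ! j = Occ)" if p: "p \<in> ?S" for p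
  proof -
    let ?X = "{b. length b = m \<and> row_weight F (Cov # Cov # b) > 0}"
    have "\<exists>r. r 0 = replicate m Bare \<and> (\<forall>d. r (Suc d) \<in> lower_next F (r d)) \<and> p = map r [1..<Suc n]"
    proof (rule path_extends_to_chain[where X = ?X])
      show "lower_next F b \<subseteq> ?X" if "b \<in> ?X" for b
        using that length_lower_next[of _ F b] by auto (simp add: lower_next_def)
    qed (use ne pos p in auto)
    then obtain r where r: "r 0 = replicate m Bare" "\<And>d. r (Suc d) \<in> lower_next F (r d)"
      and p: "p = map r [1..<Suc n]" by blast
    interpret row_chain F m r by standard (use m r in auto)
    show ?thesis using realization p row_chain_axioms by metis
  qed
  then obtain \<eta> r where
    \<eta>: "\<And>p. p \<in> ?S \<Longrightarrow> maximal_independent (\<eta> p)"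
    and r: "\<And>p. p \<in> ?S \<Longrightarrow> row_chain F m (r p)" "\<And>p. p \<in> ?S \<Longrightarrow> p = map (r p) [1..<Suc n]"
    and \<eta>r: "\<And>p d j. p \<in> ?S \<Longrightarrow> j < m \<Longrightarrow> \<eta> p (slant d j) \<longleftrightarrow> r p d ! j = Occ"
    by metis
  have "inj_on (\<lambda>p. restrict (\<eta> p) ?P) ?S"
  proof (rule inj_onI)
    fix p q assume p: "p \<in> ?S" and q: "q \<in> ?S" and eq: "restrict (\<eta> p) ?P = restrict (\<eta> q) ?P"
    have "r p d ! j = Occ \<longleftrightarrow> r q d ! j = Occ" if "d \<le> n" "j < m" for d j
    proof -
      have "slant d j \<in> ?P" using that by (force simp: parallelogram_def)
      then have "\<eta> p (slant d j) = \<eta> q (slant d j)" using eq by (metis restrict_apply')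
      then show ?thesis using \<eta>r p q that by blast
    qed
    then have "r p d = r q d" if "d \<le> n" for d
      using row_chains_agree[OF r(1)[OF p] r(1)[OF q]] that by blast
    then have "map (r p) [1..<Suc n] = map (r q) [1..<Suc n]" by (intro map_cong) auto
    then show "p = q" using r(2) p q by metis
  qed
  moreover have "(\<lambda>p. restrict (\<eta> p) ?P) ` ?S \<subseteq> patterns ?P"
    using \<eta> unfolding patterns_def by blast
  ultimately show ?thesis
    using finite_patterns[of ?P] by (intro card_inj_on_le) auto
qed

lemma certificate_le_bit_rate:
  assumes cert: "\<And>a a' b0 b1 b2 b3.
      p * (F b1 b2 b3 * G a a' b0 b1 b2) \<le> q * kink_sum F G a a' b0 b1 b2 b3"
    and base: "\<And>a a' b0 b1 b2. G a a' b0 b1 b2 > 0 \<Longrightarrow> fill_sum F True a a' [b0, b1, b2] > 0"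
    and start: "\<And>b0 b1. F Cov b0 b1 > 0 \<Longrightarrow> G Cov Cov Cov b0 b1 > 0"
    and bare: "F Cov Cov Bare > 0" "F Cov Bare Bare > 0" "F Bare Bare Bare > 0"
    and pq: "0 < p" "0 < q" and M: "\<And>x y z. F x y z \<le> M"
  shows "log 2 (real p / real q) \<le> bit_rate"
proof -
  define x where "x = real p / real q"
  have x: "x > 0" using pq by (simp add: x_def)
  obtain c :: real where c: "c > 0"
    and ne: "\<And>m b. m \<ge> 2 \<Longrightarrow> length b = m \<Longrightarrow> row_weight F (Cov # Cov # b) > 0 \<Longrightarrow> lower_next F b \<noteq> {}"
    and le: "\<And>m n b. m \<ge> 2 \<Longrightarrow> length b = m \<Longrightarrow> row_weight F (Cov # Cov # b) > 0 \<Longrightarrow>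
       (c * x ^ m) ^ n \<le> real (card (paths (lower_next F) n b)) * real (M + 1) ^ (m + 2)"
    using card_lower_paths_ge[of p F G q M, OF cert base start pq M] unfolding x_def by blast
  have pos: "row_weight F (Cov # Cov # replicate m Bare) > 0" for m
    unfolding row_weight_pos_iff using bare
    by (auto simp: nth_Cons split: nat.split)
  have "(c * x ^ m) ^ n \<le> real (card (patterns (parallelogram m (Suc n)))) * (real (M + 1) ^ 2) ^ m"
    if m: "m \<ge> 2" for m n
  proof -
    have "(c * x ^ m) ^ n \<le> real (card (paths (lower_next F) n (replicate m Bare))) * real (M + 1) ^ (m + 2)"
      by (rule le[OF m]) (simp_all add: pos del: row_weight.simps)
    also have "\<dots> \<le> real (card (patterns (parallelogram m (Suc n)))) * real (M + 1) ^ (2 * m)"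
    proof (rule mult_mono)
      show "real (card (paths (lower_next F) n (replicate m Bare))) \<le>
          real (card (patterns (parallelogram m (Suc n))))"
        using paths_le_card_patterns[where F = F and m = m and n = n, OF _ pos ne] m by simp
      show "real (M + 1) ^ (m + 2) \<le> real (M + 1) ^ (2 * m)"
        using m by (intro power_increasing) auto
    qed auto
    finally show ?thesis by (simp only: power_mult)
  qed
  then show ?thesis
    unfolding x_def[symmetric] using c x
    by (intro log_le_bit_rateI[where k = 2 and c = c and K = "real (M + 1) ^ 2"]) auto
qed

section \<open>The certificates\<close>

text \<open>The weights are tables indexed by states in the order bare, covered, occupied. The row weights
  were found by numerical optimisation of the growth factor. For given row weights \<open>F\<close>, the kink
  weights approximate the leading eigenvector of the operator that maps \<open>G\<close> to the maximum
  (for the upper bound) or minimum (for the lower bound) over \<open>b3\<close> of \<open>kink_sum F G\<close> divided by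
  \<open>F b1 b2 b3\<close>, rounded to integers. The slack between the resulting eigenvalue and the claimed
  rational factor absorbs the rounding. Entries 0 in \<open>row_weight_upper\<close> and \<open>row_weight_lower\<close> mark
  the windows that are not \<open>valid\<close>.\<close>

primrec sel :: "'a \<Rightarrow> 'a \<Rightarrow> 'a \<Rightarrow> cell \<Rightarrow> 'a" where
  "sel u c i Bare = u"
| "sel u c i Cov = c"
| "sel u c i Occ = i"

definition row_weight_upper :: "cell \<Rightarrow> cell \<Rightarrow> cell \<Rightarrow> nat" where
  "row_weight_upper =
     sel (sel (sel 31 39 36) (sel 0 43 0) (sel 32 35 35))
         (sel (sel 38 43 31) (sel 42 49 44) (sel 36 41 40))
         (sel (sel 35 29 0) (sel 0 44 0) (sel 35 39 39))"

text \<open>Dead ends carry a small positive weight here rather than 0, because a row may end before the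
  dead end takes effect.\<close>

definition kink_weight_upper :: "cell \<Rightarrow> cell \<Rightarrow> cell \<Rightarrow> cell \<Rightarrow> cell \<Rightarrow> nat" where
  "kink_weight_upper =
     sel
      (sel
        (sel (sel (sel 455 572 530) (sel 0 538 0) (sel 1 1 1))
         (sel (sel 816 879 531) (sel 948 1036 893) (sel 632 709 705))
         (sel (sel 1 1 0) (sel 0 1 0) (sel 632 709 705)))
        (sel (sel (sel 1 1 1) (sel 0 1 0) (sel 1 1 1))
         (sel (sel 1 1 1) (sel 1 1 1) (sel 794 890 885))
         (sel (sel 717 591 0) (sel 0 1010 0) (sel 794 890 885)))
        (sel (sel (sel 494 616 575) (sel 0 863 0) (sel 581 651 647))
         (sel (sel 494 616 575) (sel 673 863 831) (sel 581 651 647))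
         (sel (sel 1 1 0) (sel 0 1 0) (sel 581 651 647))))
      (sel
        (sel (sel (sel 392 493 456) (sel 0 463 0) (sel 1 1 1))
         (sel (sel 834 869 457) (sel 970 1074 927) (sel 697 781 777))
         (sel (sel 2 1 0) (sel 0 1 0) (sel 697 781 777)))
        (sel (sel (sel 636 794 759) (sel 0 747 0) (sel 1 1 1))
         (sel (sel 1057 1152 760) (sel 1247 1447 1306) (sel 905 1015 1009))
         (sel (sel 817 674 0) (sel 0 1151 0) (sel 905 1015 1009)))
        (sel (sel (sel 564 704 657) (sel 0 981 0) (sel 680 762 758))
         (sel (sel 564 704 657) (sel 764 981 944) (sel 680 762 758))
         (sel (sel 2 1 0) (sel 0 1 0) (sel 680 762 758))))
      (sel
        (sel (sel (sel 1 1 1) (sel 0 1 0) (sel 1 1 1))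
         (sel (sel 408 347 1) (sel 595 626 488) (sel 470 527 524))
         (sel (sel 1 1 0) (sel 0 1 0) (sel 470 527 524)))
        (sel (sel (sel 1 1 1) (sel 0 1 0) (sel 1 1 1))
         (sel (sel 1 1 1) (sel 1 1 1) (sel 813 911 906))
         (sel (sel 734 605 0) (sel 0 1034 0) (sel 813 911 906)))
        (sel (sel (sel 550 687 641) (sel 0 955 0) (sel 647 725 721))
         (sel (sel 550 687 641) (sel 744 955 919) (sel 647 725 721))
         (sel (sel 1 1 0) (sel 0 1 0) (sel 647 725 721))))"

definition row_weight_lower :: "cell \<Rightarrow> cell \<Rightarrow> cell \<Rightarrow> nat" where
  "row_weight_lower =
     sel (sel (sel 49 74 50) (sel 0 58 0) (sel 64 68 65))
         (sel (sel 73 92 44) (sel 54 77 67) (sel 65 69 66))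
         (sel (sel 49 43 0) (sel 0 66 0) (sel 61 65 62))"

definition kink_weight_lower :: "cell \<Rightarrow> cell \<Rightarrow> cell \<Rightarrow> cell \<Rightarrow> cell \<Rightarrow> nat" where
  "kink_weight_lower =
     sel
      (sel
        (sel (sel (sel 87 130 87) (sel 0 91 0) (sel 0 0 0))
         (sel (sel 156 191 87) (sel 144 196 167) (sel 135 143 135))
         (sel (sel 0 0 0) (sel 0 0 0) (sel 135 143 135)))
        (sel (sel (sel 0 0 0) (sel 0 0 0) (sel 0 0 0))
         (sel (sel 0 0 0) (sel 0 0 0) (sel 140 149 140))
         (sel (sel 111 99 0) (sel 0 158 0) (sel 140 149 140)))
        (sel (sel (sel 108 161 109) (sel 0 187 0) (sel 141 150 141))
         (sel (sel 108 161 109) (sel 122 187 168) (sel 141 150 141))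
         (sel (sel 0 0 0) (sel 0 0 0) (sel 141 150 141))))
      (sel
        (sel (sel (sel 77 114 77) (sel 0 80 0) (sel 0 0 0))
         (sel (sel 179 206 77) (sel 178 235 196) (sel 168 178 168))
         (sel (sel 0 0 0) (sel 0 0 0) (sel 168 178 168)))
        (sel (sel (sel 119 176 119) (sel 0 123 0) (sel 0 0 0))
         (sel (sel 186 236 119) (sel 188 264 227) (sel 186 198 186))
         (sel (sel 147 132 0) (sel 0 210 0) (sel 186 198 186)))
        (sel (sel (sel 110 163 110) (sel 0 189 0) (sel 143 152 143))
         (sel (sel 110 163 110) (sel 124 189 171) (sel 143 152 143))
         (sel (sel 0 0 0) (sel 0 0 0) (sel 143 152 143))))
      (sel
        (sel (sel (sel 0 0 0) (sel 0 0 0) (sel 0 0 0))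
         (sel (sel 69 62 0) (sel 78 98 81) (sel 78 83 78))
         (sel (sel 0 0 0) (sel 0 0 0) (sel 78 83 78)))
        (sel (sel (sel 0 0 0) (sel 0 0 0) (sel 0 0 0))
         (sel (sel 0 0 0) (sel 0 0 0) (sel 160 169 160))
         (sel (sel 126 113 0) (sel 0 180 0) (sel 160 169 160)))
        (sel (sel (sel 103 153 104) (sel 0 178 0) (sel 135 143 135))
         (sel (sel 103 153 104) (sel 116 178 160) (sel 135 143 135))
         (sel (sel 0 0 0) (sel 0 0 0) (sel 135 143 135))))"

lemma kink_sum_eq:
  "kink_sum F G a a' b0 b1 b2 b3 =
     (if allowed a' b0 b1 Bare then F a a' Bare * G a' Bare b1 b2 b3 else 0) +
     (if allowed a' b0 b1 Cov then F a a' Cov * G a' Cov b1 b2 b3 else 0) +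
     (if allowed a' b0 b1 Occ then F a a' Occ * G a' Occ b1 b2 b3 else 0)"
proof -
  have "kink_sum F G a a' b0 b1 b2 b3 =
      (\<Sum>x\<in>UNIV. if allowed a' b0 b1 x then F a a' x * G a' x b1 b2 b3 else 0)"
    unfolding kink_sum_def by (rule sum.mono_neutral_cong_left) auto
  then show ?thesis by (simp add: UNIV_cell)
qed

lemma row_weight_upper_pos: "row_weight_upper x y z > 0 \<longleftrightarrow> valid x y z"
  by (cases x; cases y; cases z) (simp_all add: row_weight_upper_def valid_def)

lemma row_weight_lower_pos: "row_weight_lower x y z > 0 \<longleftrightarrow> valid x y z"
  by (cases x; cases y; cases z) (simp_all add: row_weight_lower_def valid_def)

lemma row_weight_upper_le: "row_weight_upper x y z \<le> 49"
  by (cases x; cases y; cases z) (simp_all add: row_weight_upper_def)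

lemma row_weight_lower_le: "row_weight_lower x y z \<le> 92"
  by (cases x; cases y; cases z) (simp_all add: row_weight_lower_def)

lemma kink_weight_upper_pos: "valid b0 b1 b2 \<Longrightarrow> 1 \<le> kink_weight_upper a a' b0 b1 b2"
proof -
  have "\<forall>a a' b0 b1 b2. valid b0 b1 b2 \<longrightarrow> 1 \<le> kink_weight_upper a a' b0 b1 b2"
    unfolding all_cell by (simp add: valid_def kink_weight_upper_def)
  then show "valid b0 b1 b2 \<Longrightarrow> 1 \<le> kink_weight_upper a a' b0 b1 b2" by blast
qed

lemma kink_certificate_upper:
  "\<forall>a a' b0 b1 b2 b3. valid b0 b1 b2 \<longrightarrow> valid b1 b2 b3 \<longrightarrow>
     34 * kink_sum row_weight_upper kink_weight_upper a a' b0 b1 b2 b3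
       \<le> 43 * (row_weight_upper b1 b2 b3 * kink_weight_upper a a' b0 b1 b2)"
  unfolding kink_sum_eq allowed_def valid_def all_cell
  by (simp add: row_weight_upper_def kink_weight_upper_def)

lemma kink_certificate_lower:
  "\<forall>a a' b0 b1 b2 b3.
     21 * (row_weight_lower b1 b2 b3 * kink_weight_lower a a' b0 b1 b2)
       \<le> 17 * kink_sum row_weight_lower kink_weight_lower a a' b0 b1 b2 b3"
  unfolding kink_sum_eq allowed_def all_cell
  by (simp add: row_weight_lower_def kink_weight_lower_def)

lemma fill_sum_posI:
  assumes "allowed a' b0 b1 x" "allowed x b1 b2 y" "\<not> (b2 = Bare \<and> y = Bare)"
    and "F a a' x > 0" "F a' x y > 0"
  shows "fill_sum F e a a' [b0, b1, b2] > 0"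
proof -
  have "[x, y] \<in> fills e a' [b0, b1, b2]"
    using assms by (simp add: fills_iff All_less_Suc2 del: fills.simps)
  moreover have "row_weight F [a, a', x, y] > 0" using assms by simp
  ultimately show ?thesis unfolding fill_sum_def by (intro sum_pos2) auto
qed

lemma kink_weight_lower_completable:
  assumes "kink_weight_lower a a' b0 b1 b2 > 0"
  shows "fill_sum row_weight_lower True a a' [b0, b1, b2] > 0"
proof -
  have "\<forall>a a' b0 b1 b2. kink_weight_lower a a' b0 b1 b2 > 0 \<longrightarrow>
      (\<exists>x y. allowed a' b0 b1 x \<and> allowed x b1 b2 y \<and> \<not> (b2 = Bare \<and> y = Bare) \<and>
         valid a a' x \<and> valid a' x y)"
    unfolding all_cell ex_cell by (simp add: kink_weight_lower_def allowed_def valid_def)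
  then obtain x y where "allowed a' b0 b1 x" "allowed x b1 b2 y" "\<not> (b2 = Bare \<and> y = Bare)"
    "valid a a' x" "valid a' x y"
    using assms by blast
  then show ?thesis
    using fill_sum_posI[of a' b0 b1 x b2 y row_weight_lower a True] row_weight_lower_pos by simp
qed

lemma kink_weight_lower_start:
  "row_weight_lower Cov b0 b1 > 0 \<Longrightarrow> kink_weight_lower Cov Cov Cov b0 b1 > 0"
  by (cases b0; cases b1) (simp_all add: row_weight_lower_def kink_weight_lower_def)

text \<open>The fraction \<open>17 / 50\<close> lies slightly above \<open>log 2 (43 / 34)\<close>, which is about 0.3388.\<close>

lemma bit_rate_upper_bound: "bit_rate \<le> 17 / 50"
proof -
  have "bit_rate \<le> log 2 (real 43 / real 34)"
    by (rule bit_rate_le_certificate[where F = row_weight_upper and G = kink_weight_upper and M = 49])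
       (use kink_certificate_upper kink_weight_upper_pos row_weight_upper_pos row_weight_upper_le in auto)
  moreover have "50 * log 2 (43 / 34 :: real) \<le> 17"
  proof -
    have "50 * log 2 (43 / 34 :: real) = log 2 ((43 / 34) ^ 50)" by (subst log_nat_power) auto
    also have "\<dots> \<le> log 2 (2 ^ 17)" by (intro log_mono) (simp_all add: power_divide divide_le_eq)
    also have "\<dots> = 17" by (subst log_nat_power) auto
    finally show ?thesis .
  qed
  ultimately show ?thesis by simp
qed

text \<open>The fraction \<open>7 / 23\<close> lies slightly below \<open>log 2 (21 / 17)\<close>, which is about 0.3049.\<close>

lemma bit_rate_lower_bound: "7 / 23 \<le> bit_rate"
proof -
  have "log 2 (real 21 / real 17) \<le> bit_rate"
    by (rule certificate_le_bit_rate[where F = row_weight_lower and G = kink_weight_lower and M = 92])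
       (use kink_certificate_lower kink_weight_lower_completable kink_weight_lower_start
          row_weight_lower_le in \<open>auto simp: row_weight_lower_pos valid_def\<close>)
  moreover have "7 \<le> 23 * log 2 (21 / 17 :: real)"
  proof -
    have "7 = log 2 (2 ^ 7 :: real)" by (subst log_nat_power) auto
    also have "\<dots> \<le> log 2 ((21 / 17) ^ 23)" by (intro log_mono) (simp_all add: power_divide le_divide_eq)
    also have "\<dots> = 23 * log 2 (21 / 17)" by (subst log_nat_power) auto
    finally show ?thesis .
  qed
  ultimately show ?thesis by simp
qed

theorem theorem4p2:
  fixes \<beta> :: real
  assumes "\<beta> > 0"
  shows "((\<lambda>(m, n). box_entropy \<beta> m n) \<longlongrightarrow> H0 \<beta>) (sequentially \<times>\<^sub>F sequentially)
    \<and> 0.3012 \<le> H0 \<beta> \<and> H0 \<beta> \<le> 0.3409"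
  using box_entropy_tendsto[OF assms] bit_rate_upper_bound bit_rate_lower_bound by (simp add: H0_eq_bit_rate[OF assms])

end
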